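(* For any Colonel Blotto game with favoritism $\mathcal{CB}^F_n$: (i) There exists $\kappa=(\gamma^A,\gamma^B)\in\mathbb{R}^2_{>0}$ such that $g^A(\gamma^A,\gamma^B)=0$ and $g^B(\gamma^A,\gamma^B)=0$. (ii) For any $\kappa=(\gamma^A,\gamma^B)\in\mathbb{R}^2_{>0}$ satisfying $g^A(\gamma^A,\gamma^B)=0$ and $g^B(\gamma^A,\gamma^B)=0$, the set of distributions $\{F_{A_i^\kappa},F_{B_i^\kappa}: i\in[n]\}$ is a set of optimal univariate distributions of $\mathcal{CB}^F_n$.
   Context: **Game.** $\mathcal{CB}^F_n$ is a two-player (A and B) one-shot complete-information game with parameters: an integer $n\ge3$ (number of battlefields), budgets $0<X^A\le X^B$, $\alpha\in[0,1]$, and for each $i\in[n]=\{1,\dots,n\}$ numbers $w_i>0$, $p_i\in\mathbb{R}$, $q_i>0$. Standing assumptions: $\sum_{i}(q_iX^B-p_i)\ge X^A$, $\sum_i (X^A+p_i)/q_i\ge X^B$, and for every $i$, $q_iX^B-p_i\ge0$ and $(X^A+p_i)/q_i\ge 0$. The pure strategy set of Player $\phi\in\{A,B\}$ is $S^\phi=\{x\in\mathbb{R}^n_{\ge0}:\sum_i x_i\le X^\phi\}$. Let $\beta(x,y)=1$ if $x>y$, $\alpha$ if $x=y$, $0$ if $x<y$. For (deterministic or random) allocations $x^A,x^B$ of the two players, the payoffs are (expectations of) $\Pi^A=\sum_i w_i\,\beta(x_i^A,q_ix_i^B-p_i)$ and $\Pi^B=\sum_i w_i\,[1-\beta(x_i^A,q_ix_i^B-p_i)]$;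 the two players' randomizations are independent. **Optimal univariate distributions.** $\{F_i^A,F_i^B:i\in[n]\}$ is a set of optimal univariate distributions of $\mathcal{CB}^F_n$ if: (C.1) the supports of $F_i^A,F_i^B$ are subsets of $\mathbb{R}_{\ge0}$; (C.2) $\sum_{i\in[n]}\mathbb{E}_{x_i\sim F_i^\phi}[x_i]\le X^\phi$ for $\phi\in\{A,B\}$; (C.3) for each player $\phi$ with opponent $-\phi$: if Player $\phi$ draws her allocation to battlefield $i$ from $F_i^\phi$ for all $i$, then Player $-\phi$ has no pure strategy giving her a better payoff than when she draws her allocation to battlefield $i$ from $F_i^{-\phi}$ for all $i$. **Functions $g^A,g^B$.** For $(\gamma^A,\gamma^B)\in\mathbb{R}^2$ let $I^+=\{j:p_j\ge0,\ \gamma^B>\frac{p_j}{q_jw_j}\}$, $I^-=\{j:p_j<0,\ \gamma^A>\frac{-p_j}{w_j}\}$, $h_i=\min\{q_iw_i\gamma^B,\ w_i\gamma^A+p_i\}$, and $$g^A(\gamma^A,\gamma^B)=\sum_{i\in I^+}\frac{h_i^2-p_i^2}{2q_iw_i}+\sum_{i\in I^-}\frac{h_i^2}{2q_iw_i}-X^B\gamma^A,$$ $$g^B(\gamma^A,\gamma^B)=\sum_{i\in I^+}\frac{(h_i-p_i)^2}{2q_iw_i}+\sum_{i\in I^-}\frac{(h_i-p_i)^2-p_i^2}{2q_iw_i}-X^A\gamma^B.$$ **Distributions $F_{A_i^\kappa},F_{B_i^\kappa}$** (cumulative distribution functions on $[0,\infty)$) for $\kappa=(\gamma^A,\gamma^B)\in\mathbb{R}^2_{>0}$: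 - If $p_i\ge0$ and $q_iw_i\gamma^B-p_i\le0$: $F_{A_i^\kappa}(x)=F_{B_i^\kappa}(x)=1$ for all $x\ge0$. - If $p_i\ge0$ and $0<q_iw_i\gamma^B-p_i\le w_i\gamma^A$: $F_{A_i^\kappa}(x)=\frac{p_i+x}{q_iw_i\gamma^B}$ on $[0,q_iw_i\gamma^B-p_i]$ and $1$ beyond; $F_{B_i^\kappa}(x)=1-\frac{q_i\gamma^B}{\gamma^A}+\frac{p_i}{w_i\gamma^A}$ on $[0,\frac{p_i}{q_i})$, $=1-\frac{q_i\gamma^B}{\gamma^A}+\frac{q_ix}{w_i\gamma^A}$ on $[\frac{p_i}{q_i},w_i\gamma^B]$, and $1$ beyond. - If $p_i\ge0$ and $q_iw_i\gamma^B-p_i>w_i\gamma^A$: $F_{A_i^\kappa}(x)=1-\frac{\gamma^A}{q_i\gamma^B}+\frac{x}{q_iw_i\gamma^B}$ on $[0,w_i\gamma^A]$ and $1$ beyond; $F_{B_i^\kappa}(x)=0$ on $[0,\frac{p_i}{q_i})$, $=\frac{q_ix-p_i}{w_i\gamma^A}$ on $[\frac{p_i}{q_i},\frac{w_i\gamma^A+p_i}{q_i}]$, and $1$ beyond. - If $p_i<0$ and $w_i\gamma^A\le-p_i$: $F_{A_i^\kappa}(x)=F_{B_i^\kappa}(x)=1$ for all $x\ge0$. - If $p_i<0$ and $-p_i<w_i\gamma^A\le q_iw_i\gamma^B-p_i$: $F_{A_i^\kappa}(x)=1-\frac{\gamma^A}{q_i\gamma^B}-\frac{p_i}{q_iw_i\gamma^B}$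 on $[0,-p_i)$, $=1-\frac{\gamma^A}{q_i\gamma^B}+\frac{x}{q_iw_i\gamma^B}$ on $[-p_i,w_i\gamma^A]$, and $1$ beyond; $F_{B_i^\kappa}(x)=\frac{q_ix-p_i}{w_i\gamma^A}$ on $[0,\frac{w_i\gamma^A+p_i}{q_i}]$ and $1$ beyond. - If $p_i<0$ and $w_i\gamma^A>q_iw_i\gamma^B-p_i$: $F_{A_i^\kappa}(x)=0$ on $[0,-p_i)$, $=\frac{p_i+x}{q_iw_i\gamma^B}$ on $[-p_i,q_iw_i\gamma^B-p_i]$, and $1$ beyond; $F_{B_i^\kappa}(x)=1-\frac{q_i\gamma^B}{\gamma^A}+\frac{q_ix}{w_i\gamma^A}$ on $[0,w_i\gamma^B]$ and $1$ beyond. *)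

theory Defs
  imports "HOL-Probability.Probability"
begin

section \<open>The game\<close>

text \<open>Battlefields are numbered 1 to \<open>num_bf\<close>; the per-battlefield parameters are constrained and
  used only at those indices.\<close>

record blotto_game =
  num_bf :: nat
  budgetA :: real
  budgetB :: real
  tie :: real
  wt :: "nat \<Rightarrow> real"
  pre :: "nat \<Rightarrow> real"
  eff :: "nat \<Rightarrow> real"

abbreviation battlefields :: "blotto_game \<Rightarrow> nat set" where
  "battlefields G \<equiv> {1..num_bf G}"

definition blotto_favoritism :: "blotto_game \<Rightarrow> bool" where
  "blotto_favoritism G \<longleftrightarrow>
     num_bf G \<ge> 3 \<and> 0 < budgetA G \<and> budgetA G \<le> budgetB G \<and> 0 \<le> tie G \<and> tie G \<le> 1 \<and>
     (\<forall>i\<in>battlefields G. wt G i > 0 \<and> eff G i > 0) \<and>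
     (\<Sum>i\<in>battlefields G. eff G i * budgetB G - pre G i) \<ge> budgetA G \<and>
     (\<Sum>i\<in>battlefields G. (budgetA G + pre G i) / eff G i) \<ge> budgetB G \<and>
     (\<forall>i\<in>battlefields G. eff G i * budgetB G - pre G i \<ge> 0 \<and>
                          (budgetA G + pre G i) / eff G i \<ge> 0)"

definition pure_strategies :: "blotto_game \<Rightarrow> real \<Rightarrow> (nat \<Rightarrow> real) set" where
  "pure_strategies G X =
     {x \<in> battlefields G \<rightarrow>\<^sub>E {0..}. (\<Sum>i\<in>battlefields G. x i) \<le> X}"

definition blotto_beta :: "real \<Rightarrow> real \<Rightarrow> real \<Rightarrow> real" where
  "blotto_beta a x y = (if x > y then 1 else if x = y then a else 0)"

definition payoffA :: "blotto_game \<Rightarrow> (nat \<Rightarrow> real) \<Rightarrow> (nat \<Rightarrow> real) \<Rightarrow> real" where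
  "payoffA G x y =
     (\<Sum>i\<in>battlefields G. wt G i * blotto_beta (tie G) (x i) (eff G i * y i - pre G i))"

definition payoffB :: "blotto_game \<Rightarrow> (nat \<Rightarrow> real) \<Rightarrow> (nat \<Rightarrow> real) \<Rightarrow> real" where
  "payoffB G x y =
     (\<Sum>i\<in>battlefields G. wt G i * (1 - blotto_beta (tie G) (x i) (eff G i * y i - pre G i)))"

section \<open>Optimal univariate distributions\<close>

text \<open>Univariate distributions are given by cumulative distribution functions. For such an \<open>F\<close>,
  \<^term>\<open>interval_measure F\<close> is the Borel probability measure on the reals whose \<^const>\<open>cdf\<close> is \<open>F\<close>.\<close>

definition distribution_function :: "(real \<Rightarrow> real) \<Rightarrow> bool" where
  "distribution_function F \<longleftrightarrow>
     mono F \<and> (\<forall>x. continuous (at_right x) F) \<and>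
     (F \<longlongrightarrow> 0) at_bot \<and> (F \<longlongrightarrow> 1) at_top"

definition msupport :: "'a::topological_space measure \<Rightarrow> 'a set" where
  "msupport M = {x. \<forall>U. open U \<longrightarrow> x \<in> U \<longrightarrow> emeasure M U > 0}"

text \<open>A law of a random allocation in which the allocation to battlefield \<open>i\<close> is drawn from \<open>F i\<close>.
  Only the marginals are prescribed: the draws on different battlefields may be correlated.\<close>

definition random_allocation ::
    "blotto_game \<Rightarrow> (nat \<Rightarrow> real \<Rightarrow> real) \<Rightarrow> (nat \<Rightarrow> real) measure \<Rightarrow> bool" where
  "random_allocation G F M \<longleftrightarrow>
     prob_space M \<and> sets M = sets (PiM (battlefields G) (\<lambda>_. borel)) \<and>
     (\<forall>i\<in>battlefields G. distr M borel (\<lambda>x. x i) = interval_measure (F i))"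

text \<open>Budgets have to hold in expectation only. Integrability is required explicitly because the
  integral of a non-integrable function is 0 by convention. In the last condition the payoffs depend
  only on the marginals, so quantifying over all joint laws is harmless; the product measure expresses
  that the two players randomize independently.\<close>

definition optimal_univariate ::
    "blotto_game \<Rightarrow> (nat \<Rightarrow> real \<Rightarrow> real) \<Rightarrow> (nat \<Rightarrow> real \<Rightarrow> real) \<Rightarrow> bool" where
  "optimal_univariate G FA FB \<longleftrightarrow>
     (\<forall>i\<in>battlefields G. distribution_function (FA i) \<and> distribution_function (FB i)) \<and>
     (\<forall>i\<in>battlefields G. msupport (interval_measure (FA i)) \<subseteq> {0..} \<and>
                          msupport (interval_measure (FB i)) \<subseteq> {0..}) \<and>
     (\<forall>i\<in>battlefields G. integrable (interval_measure (FA i)) (\<lambda>x. x) \<and>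
                          integrable (interval_measure (FB i)) (\<lambda>x. x)) \<and>
     (\<Sum>i\<in>battlefields G. \<integral>x. x \<partial>interval_measure (FA i)) \<le> budgetA G \<and>
     (\<Sum>i\<in>battlefields G. \<integral>x. x \<partial>interval_measure (FB i)) \<le> budgetB G \<and>
     (\<forall>P Q. random_allocation G FA P \<longrightarrow> random_allocation G FB Q \<longrightarrow>
        (\<forall>y \<in> pure_strategies G (budgetB G).
           (\<integral>x. payoffB G x y \<partial>P) \<le> (\<integral>z. payoffB G (fst z) (snd z) \<partial>(P \<Otimes>\<^sub>M Q))) \<and>
        (\<forall>x \<in> pure_strategies G (budgetA G).
           (\<integral>y. payoffA G x y \<partial>Q) \<le> (\<integral>z. payoffA G (fst z) (snd z) \<partial>(P \<Otimes>\<^sub>M Q))))"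

section \<open>The functions \<open>g\<close> and the distributions\<close>

text \<open>\<open>a\<close> and \<open>b\<close> stand for \<open>\<gamma>\<^sup>A\<close> and \<open>\<gamma>\<^sup>B\<close>.\<close>

definition I_plus :: "blotto_game \<Rightarrow> real \<Rightarrow> nat set" where
  "I_plus G b = {j \<in> battlefields G. pre G j \<ge> 0 \<and> b > pre G j / (eff G j * wt G j)}"

definition I_minus :: "blotto_game \<Rightarrow> real \<Rightarrow> nat set" where
  "I_minus G a = {j \<in> battlefields G. pre G j < 0 \<and> a > - pre G j / wt G j}"

definition h_min :: "blotto_game \<Rightarrow> real \<Rightarrow> real \<Rightarrow> nat \<Rightarrow> real" where
  "h_min G a b i = min (eff G i * wt G i * b) (wt G i * a + pre G i)"

definition gA :: "blotto_game \<Rightarrow> real \<Rightarrow> real \<Rightarrow> real" where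
  "gA G a b =
     (\<Sum>i\<in>I_plus G b. ((h_min G a b i)\<^sup>2 - (pre G i)\<^sup>2) / (2 * eff G i * wt G i)) +
     (\<Sum>i\<in>I_minus G a. (h_min G a b i)\<^sup>2 / (2 * eff G i * wt G i)) - budgetB G * a"

definition gB :: "blotto_game \<Rightarrow> real \<Rightarrow> real \<Rightarrow> real" where
  "gB G a b =
     (\<Sum>i\<in>I_plus G b. (h_min G a b i - pre G i)\<^sup>2 / (2 * eff G i * wt G i)) +
     (\<Sum>i\<in>I_minus G a. ((h_min G a b i - pre G i)\<^sup>2 - (pre G i)\<^sup>2) / (2 * eff G i * wt G i)) -
     budgetA G * b"

definition distA :: "blotto_game \<Rightarrow> real \<Rightarrow> real \<Rightarrow> nat \<Rightarrow> real \<Rightarrow> real" where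
  "distA G a b i x =
    (let w = wt G i; p = pre G i; q = eff G i in
     if x < 0 then 0
     else if p \<ge> 0 then
       (if q * w * b - p \<le> 0 then 1
        else if q * w * b - p \<le> w * a then
          (if x \<le> q * w * b - p then (p + x) / (q * w * b) else 1)
        else
          (if x \<le> w * a then 1 - a / (q * b) + x / (q * w * b) else 1))
     else
       (if w * a \<le> - p then 1
        else if w * a \<le> q * w * b - p then
          (if x < - p then 1 - a / (q * b) - p / (q * w * b)
           else if x \<le> w * a then 1 - a / (q * b) + x / (q * w * b) else 1)
        else
          (if x < - p then 0
           else if x \<le> q * w * b - p then (p + x) / (q * w * b) else 1)))"

definition distB :: "blotto_game \<Rightarrow> real \<Rightarrow> real \<Rightarrow> nat \<Rightarrow> real \<Rightarrow> real" where
  "distB G a b i x =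
    (let w = wt G i; p = pre G i; q = eff G i in
     if x < 0 then 0
     else if p \<ge> 0 then
       (if q * w * b - p \<le> 0 then 1
        else if q * w * b - p \<le> w * a then
          (if x < p / q then 1 - q * b / a + p / (w * a)
           else if x \<le> w * b then 1 - q * b / a + q * x / (w * a) else 1)
        else
          (if x < p / q then 0
           else if x \<le> (w * a + p) / q then (q * x - p) / (w * a) else 1))
     else
       (if w * a \<le> - p then 1
        else if w * a \<le> q * w * b - p then
          (if x \<le> (w * a + p) / q then (q * x - p) / (w * a) else 1)
        else
          (if x \<le> w * b then 1 - q * b / a + q * x / (w * a) else 1)))"

end

theory Submission
  imports Defs
begin

text \<open>
  Write \<open>g\<^sup>A = S\<^sup>B - X\<^sup>B a\<close> and \<open>g\<^sup>B = S\<^sup>A - X\<^sup>A b\<close>, where \<open>S\<^sup>B\<close> and \<open>S\<^sup>A\<close> are sums over the battlefields.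
  Exchanging the players amounts to replacing \<open>(q, p, a, b)\<close> by \<open>(1/q, -p/q, b, a)\<close>, and this turns the
  summands of \<open>S\<^sup>B\<close> into those of \<open>S\<^sup>A\<close> and the distributions of player B into those of player A.

  For (i), along every ray \<open>b = \<rho> a\<close> both \<open>S\<^sup>B / a\<close> and \<open>S\<^sup>A / b\<close> increase strictly from 0 to infinity once
  they are positive, so each of the two equations has exactly one root on the ray, which depends
  continuously on \<open>\<rho>\<close>. For large and for small \<open>\<rho>\<close> the two roots come in opposite orders because
  \<open>S\<^sup>B = O(b\<^sup>2)\<close> and \<open>S\<^sup>A = O(a\<^sup>2)\<close>; hence they coincide for some \<open>\<rho>\<close>.

  For (ii), \<open>1/a\<close> and \<open>1/b\<close> act as Lagrange multipliers of the two budgets: against the opponent's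
  distributions a pure allocation is worth at most an affine function of the budget it spends. The two
  resulting upper bounds add up to the total weight of the battlefields, and so do the two
  payoffs, so that both bounds are attained by the distributions themselves. No analysis of ties is needed.
\<close>

section \<open>Zeros of superhomogeneous systems in the quadrant\<close>

text \<open>\<open>superhom\<close> says that \<open>F\<close> divided by its first argument
  increases strictly along a ray once it is positive, so the ray of slope \<open>\<rho>\<close>
  meets \<open>F a b = X * a\<close> exactly once, at \<open>a = R \<rho>\<close>. The equivalence
  with \<open>r < R \<rho>\<close> turns comparisons with the root into inequalities for
  \<open>F\<close>, which yields both monotonicity and continuity of \<open>R\<close>.\<close>

lemma ray_root:
  fixes F :: "real \<Rightarrow> real \<Rightarrow> real" and K X :: real
  assumes cont: "continuous_on UNIV (\<lambda>z. F (fst z) (snd z))"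
    and K: "K > 0" and X: "X > 0"
    and upper: "\<And>a b. F a b \<le> K * b\<^sup>2"
    and mono: "\<And>a b b'. b \<le> b' \<Longrightarrow> F a b \<le> F a b'"
    and superhom: "\<And>a b t. a > 0 \<Longrightarrow> b > 0 \<Longrightarrow> t > 1 \<Longrightarrow> F a b > 0 \<Longrightarrow> F (t * a) (t * b) > t * F a b"
    and unbounded: "\<And>a b. a > 0 \<Longrightarrow> b > 0 \<Longrightarrow> \<exists>t>0. F (t * a) (t * b) > X * (t * a)"
  obtains R where "\<And>\<rho>. \<rho> > 0 \<Longrightarrow> R \<rho> > 0"
    and "\<And>\<rho>. \<rho> > 0 \<Longrightarrow> F (R \<rho>) (\<rho> * R \<rho>) = X * R \<rho>"
    and "\<And>\<rho> r. \<rho> > 0 \<Longrightarrow> r > 0 \<Longrightarrow> F r (\<rho> * r) < X * r \<longleftrightarrow> r < R \<rho>"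
    and "\<And>\<rho> \<sigma>. 0 < \<sigma> \<Longrightarrow> \<sigma> \<le> \<rho> \<Longrightarrow> R \<rho> \<le> R \<sigma>"
    and "continuous_on {0<..} R"
proof -
  have contF: "continuous_on A (\<lambda>x. F (f x) (g x))"
    if "continuous_on A f" "continuous_on A g" for f g :: "real \<Rightarrow> real" and A
    using continuous_on_compose2[OF cont, of A "\<lambda>x. (f x, g x)"] that
    by (auto intro: continuous_on_Pair)
  have root: "\<exists>r>0. F r (\<rho> * r) = X * r" if \<rho>: "\<rho> > 0" for \<rho>
  proof -
    obtain T where T: "T > 0" "F T (\<rho> * T) > X * T"
      using unbounded[of 1 \<rho>] \<rho> by (auto simp: mult.commute)
    \<comment> \<open>Near 0 the quadratic bound on \<open>F\<close> beats the linear term: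
      \<open>K * \<rho>\<^sup>2 * e \<le> X\<close> gives the sign needed at the left end, and
      \<open>e \<le> T\<close> orders the interval for the intermediate value theorem.\<close>
    define e where "e = min T (X / (K * \<rho>\<^sup>2))"
    have e: "e > 0" "e \<le> T" "K * \<rho>\<^sup>2 * e \<le> X"
      using T X K \<rho> by (auto simp: e_def min_def field_simps)
    have "F e (\<rho> * e) \<le> (K * \<rho>\<^sup>2 * e) * e"
      using upper[of e "\<rho> * e"] by (simp add: power2_eq_square mult_ac)
    also have "\<dots> \<le> X * e" using e by (intro mult_right_mono) auto
    finally have lo: "F e (\<rho> * e) - X * e \<le> 0" by simp
    have "continuous_on {e..T} (\<lambda>r. F r (\<rho> * r) - X * r)"
      by (intro continuous_intros contF)
    with lo e T have "\<exists>r\<ge>e. r \<le> T \<and> F r (\<rho> * r) - X * r = 0"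
      by (intro IVT') auto
    with e show ?thesis by (metis diff_eq_eq add_0 less_le_trans)
  qed
  then obtain R where R: "\<And>\<rho>. \<rho> > 0 \<Longrightarrow> R \<rho> > 0" "\<And>\<rho>. \<rho> > 0 \<Longrightarrow> F (R \<rho>) (\<rho> * R \<rho>) = X * R \<rho>"
    by metis
  \<comment> \<open>Once \<open>F\<close> has reached the line \<open>X * r\<close> it stays
    strictly above it; this gives uniqueness of the root and both comparisons below.\<close>
  have up: "X * s < F s (\<rho> * s)"
    if "\<rho> > 0" "0 < r" "r < s" "X * r \<le> F r (\<rho> * r)" for r s \<rho>
  proof -
    have "s / r * F r (\<rho> * r) < F (s / r * r) (s / r * (\<rho> * r))"
      using that X by (intro superhom) (auto intro: less_le_trans[of _ "X * r"])
    moreover have "X * s \<le> s / r * F r (\<rho> * r)"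
      using that by (simp add: field_simps)
    ultimately show ?thesis using that by (simp add: mult_ac)
  qed
  have less: "F r (\<rho> * r) < X * r \<longleftrightarrow> r < R \<rho>" if "\<rho> > 0" "r > 0" for \<rho> r
    using up[of \<rho> r "R \<rho>"] up[of \<rho> "R \<rho>" r] R[of \<rho>] that
    by (metis less_irrefl linorder_less_linear linorder_not_le order_less_imp_le)
  have greater: "X * r < F r (\<rho> * r) \<longleftrightarrow> R \<rho> < r" if "\<rho> > 0" "r > 0" for \<rho> r
    using up[of \<rho> r "R \<rho>"] up[of \<rho> "R \<rho>" r] R[of \<rho>] that
    by (metis less_irrefl linorder_less_linear linorder_not_le order_less_imp_le)
  have anti: "R \<rho> \<le> R \<sigma>" if "0 < \<sigma>" "\<sigma> \<le> \<rho>" for \<rho> \<sigma>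
  proof -
    have "X * R \<sigma> \<le> F (R \<sigma>) (\<rho> * R \<sigma>)"
      using R[of \<sigma>] mono[of "\<sigma> * R \<sigma>" "\<rho> * R \<sigma>" "R \<sigma>"] that by (simp add: mult_right_mono)
    then show ?thesis using less[of \<rho> "R \<sigma>"] R[of \<sigma>] that by auto
  qed
  \<comment> \<open>For fixed positive \<open>l\<close>, the condition \<open>l < R \<sigma>\<close>
    is a strict inequality between continuous functions of \<open>\<sigma>\<close>, hence open;
    likewise for \<open>R \<sigma> < u\<close>.\<close>
  have "(R \<longlongrightarrow> R \<rho>) (at \<rho>)" if \<rho>: "\<rho> > 0" for \<rho>
  proof (rule order_tendstoI)
    have ev: "eventually (\<lambda>\<sigma>. \<sigma> > 0) (at \<rho>)"
      using \<rho> by (intro order_tendstoD(1)[OF tendsto_ident_at])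
    have tends: "((\<lambda>\<sigma>. F l (\<sigma> * l)) \<longlongrightarrow> F l (\<rho> * l)) (at \<rho>)" for l
    proof -
      have "continuous_on UNIV (\<lambda>\<sigma>. F l (\<sigma> * l))" by (intro contF continuous_intros)
      then show ?thesis by (simp add: continuous_on_def)
    qed
    show "eventually (\<lambda>\<sigma>. l < R \<sigma>) (at \<rho>)" if "l < R \<rho>" for l
    proof (cases "l > 0")
      case True
      then have "eventually (\<lambda>\<sigma>. F l (\<sigma> * l) < X * l) (at \<rho>)"
        using that \<rho> less by (intro order_tendstoD(2)[OF tends]) auto
      with ev show ?thesis by eventually_elim (use less True in auto)
    next
      case False
      from ev show ?thesis by eventually_elim (use R False in force)
    qed
    show "eventually (\<lambda>\<sigma>. R \<sigma> < u) (at \<rho>)" if "R \<rho> < u" for u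
    proof -
      have u: "u > 0" using R[of \<rho>] \<rho> that by auto
      then have "eventually (\<lambda>\<sigma>. X * u < F u (\<sigma> * u)) (at \<rho>)"
        using that \<rho> greater by (intro order_tendstoD(1)[OF tends]) auto
      with ev show ?thesis by eventually_elim (use greater u in auto)
    qed
  qed
  then have "continuous_on {0<..} R"
    by (intro continuous_at_imp_continuous_on) (auto simp: isCont_def)
  with R less anti show ?thesis using that by blast
qed

text \<open>The arguments of \<open>G\<close> are exchanged in the conclusion, so the ray of slope
  \<open>\<rho>\<close> for \<open>F\<close> is the ray of slope \<open>1 / \<rho>\<close> for
  \<open>G\<close>. The two solution curves are compared along common rays, and the intermediate
  value theorem provides a crossing.\<close>

lemma quadrant_zero:
  fixes F G :: "real \<Rightarrow> real \<Rightarrow> real" and K L X Y :: real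
  assumes contF: "continuous_on UNIV (\<lambda>z. F (fst z) (snd z))"
    and contG: "continuous_on UNIV (\<lambda>z. G (fst z) (snd z))"
    and pos: "K > 0" "L > 0" "X > 0" "Y > 0"
    and upperF: "\<And>a b. F a b \<le> K * b\<^sup>2" and upperG: "\<And>a b. G a b \<le> L * b\<^sup>2"
    and monoF: "\<And>a b b'. b \<le> b' \<Longrightarrow> F a b \<le> F a b'"
    and monoG: "\<And>a b b'. b \<le> b' \<Longrightarrow> G a b \<le> G a b'"
    and superF: "\<And>a b t. a > 0 \<Longrightarrow> b > 0 \<Longrightarrow> t > 1 \<Longrightarrow> F a b > 0 \<Longrightarrow> F (t * a) (t * b) > t * F a b"
    and superG: "\<And>a b t. a > 0 \<Longrightarrow> b > 0 \<Longrightarrow> t > 1 \<Longrightarrow> G a b > 0 \<Longrightarrow> G (t * a) (t * b) > t * G a b"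
    and unbF: "\<And>a b. a > 0 \<Longrightarrow> b > 0 \<Longrightarrow> \<exists>t>0. F (t * a) (t * b) > X * (t * a)"
    and unbG: "\<And>a b. a > 0 \<Longrightarrow> b > 0 \<Longrightarrow> \<exists>t>0. G (t * a) (t * b) > Y * (t * a)"
  shows "\<exists>a b. a > 0 \<and> b > 0 \<and> F a b = X * a \<and> G b a = Y * b"
proof -
  obtain R where R: "\<And>\<rho>. \<rho> > 0 \<Longrightarrow> R \<rho> > 0"
      "\<And>\<rho>. \<rho> > 0 \<Longrightarrow> F (R \<rho>) (\<rho> * R \<rho>) = X * R \<rho>"
      "\<And>\<rho> r. \<rho> > 0 \<Longrightarrow> r > 0 \<Longrightarrow> F r (\<rho> * r) < X * r \<longleftrightarrow> r < R \<rho>"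
      "\<And>\<rho> \<sigma>. 0 < \<sigma> \<Longrightarrow> \<sigma> \<le> \<rho> \<Longrightarrow> R \<rho> \<le> R \<sigma>" "continuous_on {0<..} R"
    by (rule ray_root[OF contF pos(1,3)])
      ((rule upperF | erule monoF | (rule superF; assumption) | (rule unbF; assumption) | (rule that; assumption))+)
  obtain S where S: "\<And>\<rho>. \<rho> > 0 \<Longrightarrow> S \<rho> > 0"
      "\<And>\<rho>. \<rho> > 0 \<Longrightarrow> G (S \<rho>) (\<rho> * S \<rho>) = Y * S \<rho>"
      "\<And>\<rho> r. \<rho> > 0 \<Longrightarrow> r > 0 \<Longrightarrow> G r (\<rho> * r) < Y * r \<longleftrightarrow> r < S \<rho>"
      "\<And>\<rho> \<sigma>. 0 < \<sigma> \<Longrightarrow> \<sigma> \<le> \<rho> \<Longrightarrow> S \<rho> \<le> S \<sigma>" "continuous_on {0<..} S"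
    by (rule ray_root[OF contG pos(2,4)])
      ((rule upperG | erule monoG | (rule superG; assumption) | (rule unbG; assumption) | (rule that; assumption))+)
  have small: "\<exists>\<rho>\<ge>1. F (S \<rho> * \<rho>) (S \<rho>) < X * (S \<rho> * \<rho>)"
  proof -
    \<comment> \<open>Since \<open>S \<rho> \<le> S 1\<close>, the bound
      \<open>K * (S \<rho>)\<^sup>2\<close> is at most \<open>K * S 1 * S \<rho>\<close>, and
      \<open>\<rho>\<close> is chosen to make this smaller than
      \<open>X * \<rho> * S \<rho>\<close>.\<close>
    define \<rho> where "\<rho> = 1 + K * S 1 / X"
    have \<rho>: "\<rho> \<ge> 1" "K * S 1 < X * \<rho>" using pos S(1)[of 1] by (auto simp: \<rho>_def field_simps)
    have s: "S \<rho> > 0" "S \<rho> \<le> S 1" using S(1,4)[of 1] S(1)[of \<rho>] \<rho> S(4)[of 1 \<rho>] by auto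
    have "F (S \<rho> * \<rho>) (S \<rho>) \<le> K * S \<rho> * S \<rho>" using upperF by (simp add: power2_eq_square mult.assoc)
    also have "\<dots> \<le> K * S 1 * S \<rho>" using s pos by (intro mult_right_mono mult_left_mono) auto
    also have "\<dots> < X * \<rho> * S \<rho>" using \<rho> s by (intro mult_strict_right_mono) auto
    finally show ?thesis using \<rho> by (auto simp: mult_ac)
  qed
  have large: "\<exists>\<rho>\<ge>1. G (R \<rho> * \<rho>) (R \<rho>) < Y * (R \<rho> * \<rho>)"
  proof -
    define \<rho> where "\<rho> = 1 + L * R 1 / Y"
    have \<rho>: "\<rho> \<ge> 1" "L * R 1 < Y * \<rho>" using pos R(1)[of 1] by (auto simp: \<rho>_def field_simps)
    have s: "R \<rho> > 0" "R \<rho> \<le> R 1" using R(1,4)[of 1] R(1)[of \<rho>] \<rho> R(4)[of 1 \<rho>] by auto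
    have "G (R \<rho> * \<rho>) (R \<rho>) \<le> L * R \<rho> * R \<rho>" using upperG by (simp add: power2_eq_square mult.assoc)
    also have "\<dots> \<le> L * R 1 * R \<rho>" using s pos by (intro mult_right_mono mult_left_mono) auto
    also have "\<dots> < Y * \<rho> * R \<rho>" using \<rho> s by (intro mult_strict_right_mono) auto
    finally show ?thesis using \<rho> by (auto simp: mult_ac)
  qed
  \<comment> \<open>On the ray \<open>b = \<rho> * a\<close>, the root of the \<open>G\<close>
    equation has \<open>b = S (1 / \<rho>)\<close>, hence
    \<open>a = S (1 / \<rho>) / \<rho>\<close>; \<open>D\<close> is the difference of the two values
    of \<open>a\<close>.\<close>
  define D where "D \<rho> = S (1 / \<rho>) / \<rho> - R \<rho>" for \<rho>
  obtain \<sigma> where \<sigma>: "\<sigma> \<ge> 1" "F (S \<sigma> * \<sigma>) (S \<sigma>) < X * (S \<sigma> * \<sigma>)" using small by auto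
  obtain \<tau> where \<tau>: "\<tau> \<ge> 1" "G (R \<tau> * \<tau>) (R \<tau>) < Y * (R \<tau> * \<tau>)" using large by auto
  have gt_0: "\<rho> > 0" if "1 / \<sigma> \<le> \<rho>" for \<rho>
    using \<sigma> that by (intro less_le_trans[OF _ that]) auto
  have "D (1 / \<sigma>) \<le> 0"
    using R(3)[of "1 / \<sigma>" "S \<sigma> * \<sigma>"] S(1)[of \<sigma>] \<sigma> by (simp add: D_def)
  moreover have "0 \<le> D \<tau>"
    using S(3)[of "1 / \<tau>" "R \<tau> * \<tau>"] R(1)[of \<tau>] \<tau> by (simp add: D_def field_simps)
  moreover have "continuous_on {1 / \<sigma>..\<tau>} D"
    unfolding D_def
    by (intro continuous_intros continuous_on_compose2[OF S(5)] continuous_on_subset[OF R(5)])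
       (use \<sigma>(1) in \<open>auto dest: gt_0\<close>)
  moreover have "1 / \<sigma> \<le> \<tau>" using \<sigma> \<tau> by (auto intro: order_trans[of "1 / \<sigma>" 1 \<tau>])
  ultimately obtain \<rho> where \<rho>: "\<rho> \<ge> 1 / \<sigma>" "D \<rho> = 0"
    using IVT'[of D "1 / \<sigma>" 0 \<tau>] by auto
  then have "\<rho> > 0" using gt_0 by auto
  have S_eq: "S (1 / \<rho>) = \<rho> * R \<rho>" using \<rho> \<open>\<rho> > 0\<close> by (simp add: D_def field_simps)
  have "1 / \<rho> * (\<rho> * R \<rho>) = R \<rho>" using \<open>\<rho> > 0\<close> by simp
  then have "G (\<rho> * R \<rho>) (R \<rho>) = Y * (\<rho> * R \<rho>)"
    using S(2)[of "1 / \<rho>"] \<open>\<rho> > 0\<close> unfolding S_eq by simp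
  with R(1,2)[of \<rho>] \<open>\<rho> > 0\<close> show ?thesis
    by (meson mult_pos_pos)
qed

section \<open>The system defining \<open>\<kappa>\<close>\<close>

text \<open>This is \<open>h_min\<close> with explicit parameters instead of a game, so that
  exchanging the players becomes a substitution.\<close>

definition blotto_h :: "real \<Rightarrow> real \<Rightarrow> real \<Rightarrow> real \<Rightarrow> real \<Rightarrow> real" where
  "blotto_h q w p a b = min (q * w * b) (w * a + p)"

text \<open>The battlefield's share of \<open>g\<^sup>A + X\<^sup>B a\<close>, so that \<open>spending / a\<close> is the mean allocation of player B.\<close>

definition spending :: "real \<Rightarrow> real \<Rightarrow> real \<Rightarrow> real \<Rightarrow> real \<Rightarrow> real" where
  "spending q w p a b =
     ((max (blotto_h q w p a b) (max 0 p))\<^sup>2 - (max 0 p)\<^sup>2) / (2 * q * w)"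

lemma blotto_h_swap:
  assumes "q > 0"
  shows "blotto_h (1 / q) w (- p / q) b a = (blotto_h q w p a b - p) / q"
  using assms by (auto simp: blotto_h_def min_def field_simps)

lemma spending_nonneg:
  assumes "q > 0" "w > 0"
  shows "spending q w p a b \<ge> 0"
  unfolding spending_def using assms by (intro divide_nonneg_pos) (auto intro!: power_mono)

lemma spending_mono:
  assumes "q > 0" "w > 0" "b \<le> b'"
  shows "spending q w p a b \<le> spending q w p a b'"
proof -
  have "blotto_h q w p a b \<le> blotto_h q w p a b'"
    unfolding blotto_h_def using assms by (intro min.mono mult_left_mono) auto
  then show ?thesis unfolding spending_def using assms
    by (intro divide_right_mono diff_right_mono power_mono) auto
qed

lemma spending_le:
  assumes "q > 0" "w > 0"
  shows "spending q w p a b \<le> q * w / 2 * b\<^sup>2"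
proof -
  have "max (blotto_h q w p a b) (max 0 p) \<le> max (q * w * b) (max 0 p)"
    by (auto simp: blotto_h_def)
  then have "(max (blotto_h q w p a b) (max 0 p))\<^sup>2 - (max 0 p)\<^sup>2 \<le> (max (q * w * b) (max 0 p))\<^sup>2 - (max 0 p)\<^sup>2"
    by (intro diff_right_mono power_mono) auto
  also have "\<dots> \<le> (q * w * b)\<^sup>2" by (auto simp: max_def)
  finally show ?thesis using assms
    by (simp add: spending_def field_simps power2_eq_square)
qed

lemma continuous_on_spending:
  "continuous_on UNIV (\<lambda>z. spending q w p (fst z) (snd z))"
  unfolding spending_def blotto_h_def divide_inverse by (intro continuous_intros)

lemma spending_posD:
  assumes "spending q w p a b > 0"
  shows "blotto_h q w p a b > max 0 p"
    and "spending q w p a b = ((blotto_h q w p a b)\<^sup>2 - (max 0 p)\<^sup>2) / (2 * q * w)"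
proof -
  show less: "blotto_h q w p a b > max 0 p"
  proof (rule ccontr)
    assume "\<not> max 0 p < blotto_h q w p a b"
    then have "max (blotto_h q w p a b) (max 0 p) = max 0 p" by (intro max_absorb2) (simp only: not_less)
    then have "spending q w p a b = 0" by (simp only: spending_def) simp
    with assms show False by simp
  qed
  have "max (blotto_h q w p a b) (max 0 p) = blotto_h q w p a b"
    using less by (rule max_absorb1[OF less_imp_le])
  then show "spending q w p a b = ((blotto_h q w p a b)\<^sup>2 - (max 0 p)\<^sup>2) / (2 * q * w)"
    by (simp only: spending_def)
qed

text \<open>Squares scale by \<open>t\<^sup>2 > t\<close>. The only obstruction is the constant
  \<open>p\<close> in the affine branch of the minimum, which does not scale; there the subtracted
  square cancels its contribution.\<close>

lemma spending_superhom:
  assumes "q > 0" "w > 0" "a > 0" "b > 0" "t > 1" "spending q w p a b > 0"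
  shows "spending q w p (t * a) (t * b) > t * spending q w p a b"
proof -
  let ?h = "blotto_h q w p a b" and ?k = "blotto_h q w p (t * a) (t * b)" and ?m = "max 0 p"
  note h = spending_posD(1)[OF assms(6)] and sp = spending_posD(2)[OF assms(6)]
  have "t * (?h\<^sup>2 - ?m\<^sup>2) < ?k\<^sup>2 - ?m\<^sup>2"
  proof (cases "?k \<ge> t * ?h")
    case True
    have "0 < t * (t - 1) * ?h\<^sup>2 + (t - 1) * ?m\<^sup>2"
      using assms h by (intro add_pos_nonneg mult_pos_pos) auto
    also have "\<dots> = (t * ?h)\<^sup>2 - t * ?h\<^sup>2 + (t - 1) * ?m\<^sup>2"
      by (simp add: algebra_simps power2_eq_square)
    also have "(t * ?h)\<^sup>2 \<le> ?k\<^sup>2" using True h assms by (intro power_mono) auto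
    finally show ?thesis by (simp add: algebra_simps)
  \<comment> \<open>If \<open>?k < t * ?h\<close>, the minimum \<open>?k\<close> must be its affine
    branch, and the deficit forces \<open>p > 0\<close>. With \<open>u = w * a\<close>, the gain of
    \<open>(t * u + p)\<^sup>2 - p\<^sup>2\<close> over
    \<open>t * ((u + p)\<^sup>2 - p\<^sup>2)\<close> is exactly
    \<open>t * (t - 1) * u\<^sup>2\<close>.\<close>
  next
    case False
    have "q * w * (t * b) \<ge> t * ?h"
      using assms by (simp add: blotto_h_def min_def mult_ac)
    with False have k: "?k = t * (w * a) + p" by (auto simp: blotto_h_def min_def mult_ac split: if_splits)
    have hu: "?h \<le> w * a + p" by (simp add: blotto_h_def)
    have "t * ?h \<le> t * (w * a + p)" using hu assms by (intro mult_left_mono) auto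
    with False k have "(t - 1) * p > 0" by (auto simp: algebra_simps)
    then have p: "p > 0" using assms by (simp add: zero_less_mult_iff)
    have u: "w * a > 0" using assms by simp
    have "?h\<^sup>2 \<le> (w * a + p)\<^sup>2" using hu h by (intro power_mono) auto
    then have "t * (?h\<^sup>2 - p\<^sup>2) \<le> t * ((w * a + p)\<^sup>2 - p\<^sup>2)"
      using assms by (intro mult_left_mono) auto
    also have "\<dots> = (t * (w * a) + p)\<^sup>2 - p\<^sup>2 - t * (t - 1) * (w * a)\<^sup>2"
      by (simp add: algebra_simps power2_eq_square)
    also have "\<dots> < (t * (w * a) + p)\<^sup>2 - p\<^sup>2" using u assms by simp
    finally show ?thesis using p k by simp
  qed
  \<comment> \<open>Positivity is what lets \<open>?k\<^sup>2\<close> be bounded by the square of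
    the maximum in \<open>spending\<close>.\<close>
  moreover have "?k > 0"
  proof -
    have "w * a \<le> t * (w * a)" using assms by simp
    moreover have "0 < q * w * (t * b)" using assms by simp
    moreover have "0 < w * a + p" using h by (simp add: blotto_h_def)
    ultimately show ?thesis by (simp add: blotto_h_def mult_ac)
  qed
  then have "?k\<^sup>2 \<le> (max ?k ?m)\<^sup>2" by (intro power_mono) auto
  ultimately have "t * (?h\<^sup>2 - ?m\<^sup>2) < (max ?k ?m)\<^sup>2 - ?m\<^sup>2" by simp
  then have "t * (?h\<^sup>2 - ?m\<^sup>2) / (2 * q * w) < ((max ?k ?m)\<^sup>2 - ?m\<^sup>2) / (2 * q * w)"
    using assms by (intro divide_strict_right_mono) auto
  then show ?thesis unfolding sp by (simp add: spending_def)
qed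

text \<open>The numerator is \<open>(t * m - \<bar>p\<bar>)\<^sup>2 - p\<^sup>2\<close>, because
  \<open>p\<close> shifts \<open>h\<close> by at most \<open>\<bar>p\<bar>\<close>; where the square
  is not monotone the bound is nonpositive. It makes the growth along a ray quadratic in
  \<open>t\<close>.\<close>

lemma spending_lower:
  fixes a b p q t w :: real
  assumes "q > 0" "w > 0" "t > 0" "a > 0" "b > 0"
  defines "m \<equiv> min (q * w * b) (w * a)"
  shows "spending q w p (t * a) (t * b) \<ge> ((t * m)\<^sup>2 - 2 * (t * m) * \<bar>p\<bar>) / (2 * q * w)"
proof (cases "t * m \<ge> \<bar>p\<bar>")
  case True
  have "t * m \<le> t * (q * w * b)" "t * m \<le> t * (w * a)"
    using assms by (auto simp: m_def intro!: mult_left_mono)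
  then have "t * m - \<bar>p\<bar> \<le> blotto_h q w p (t * a) (t * b)"
    by (auto simp: blotto_h_def mult_ac)
  then have "t * m - \<bar>p\<bar> \<le> max (blotto_h q w p (t * a) (t * b)) (max 0 p)" by simp
  with True have "(t * m - \<bar>p\<bar>)\<^sup>2 \<le> (max (blotto_h q w p (t * a) (t * b)) (max 0 p))\<^sup>2"
    by (intro power_mono) auto
  moreover have "(max 0 p)\<^sup>2 \<le> p\<^sup>2" by (auto simp: max_def)
  moreover have "(t * m - \<bar>p\<bar>)\<^sup>2 = (t * m)\<^sup>2 - 2 * (t * m) * \<bar>p\<bar> + p\<^sup>2"
    by (simp add: power2_diff)
  ultimately show ?thesis unfolding spending_def using assms
    by (intro divide_right_mono) auto
next
  case False
  have "0 \<le> t * m" using assms by (simp add: m_def)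
  with False have "t * m * (t * m - 2 * \<bar>p\<bar>) \<le> 0" by (intro mult_nonneg_nonpos) auto
  then have "((t * m)\<^sup>2 - 2 * (t * m) * \<bar>p\<bar>) / (2 * q * w) \<le> 0"
    using assms by (intro divide_nonpos_pos) (auto simp: algebra_simps power2_eq_square)
  with spending_nonneg[OF assms(1,2)] show ?thesis by (meson order_trans)
qed

section \<open>Total spending and existence of a solution\<close>

lemma sum_spending_unbounded:
  fixes q w p :: "'a \<Rightarrow> real" and a b c :: real
  assumes "finite I" "I \<noteq> {}" "\<And>i. i \<in> I \<Longrightarrow> q i > 0 \<and> w i > 0" "a > 0" "b > 0"
  shows "\<exists>t>0. (\<Sum>i\<in>I. spending (q i) (w i) (p i) (t * a) (t * b)) > c * t"
proof -
  define m where "m i = min (q i * w i * b) (w i * a)" for i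
  define C where "C = (\<Sum>i\<in>I. (m i)\<^sup>2 / (2 * q i * w i))"
  define D where "D = (\<Sum>i\<in>I. 2 * m i * \<bar>p i\<bar> / (2 * q i * w i))"
  have "m i > 0" if "i \<in> I" for i
    using assms(3)[OF that] assms(4,5) by (simp add: m_def)
  then have "C > 0" unfolding C_def using assms
    by (intro sum_pos divide_pos_pos zero_less_power mult_pos_pos) auto
  \<comment> \<open>The lower bound for the sum is \<open>(C * t - D) * t\<close>; this
    \<open>t\<close> makes the bracket exceed \<open>c\<close>, and the absolute value keeps
    \<open>t\<close> positive.\<close>
  define t where "t = (1 + \<bar>c + D\<bar>) / C"
  have t: "t > 0" "C * t > c + D" using \<open>C > 0\<close> by (auto simp: t_def)
  have "c * t < (C * t - D) * t" using t by (intro mult_strict_right_mono) auto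
  also have "\<dots> = (\<Sum>i\<in>I. ((t * m i)\<^sup>2 - 2 * (t * m i) * \<bar>p i\<bar>) / (2 * q i * w i))"
    unfolding C_def D_def sum_distrib_right sum_subtractf[symmetric]
    by (intro sum.cong refl) (simp add: algebra_simps diff_divide_distrib power2_eq_square)
  also have "\<dots> \<le> (\<Sum>i\<in>I. spending (q i) (w i) (p i) (t * a) (t * b))"
    unfolding m_def using assms t by (intro sum_mono spending_lower) auto
  finally show ?thesis using t by auto
qed

text \<open>Battlefields with zero spending contribute only a weak inequality; strictness comes from
  one battlefield \<open>j\<close> with positive spending, which exists because the sum is
  positive.\<close>

lemma sum_spending_superhom:
  fixes q w p :: "'a \<Rightarrow> real" and a b t :: real
  assumes "finite I" "\<And>i. i \<in> I \<Longrightarrow> q i > 0 \<and> w i > 0" "a > 0" "b > 0" "t > 1"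
    and "(\<Sum>i\<in>I. spending (q i) (w i) (p i) a b) > 0"
  shows "(\<Sum>i\<in>I. spending (q i) (w i) (p i) (t * a) (t * b)) >
    t * (\<Sum>i\<in>I. spending (q i) (w i) (p i) a b)"
proof -
  obtain j where j: "j \<in> I" "spending (q j) (w j) (p j) a b > 0"
    using assms(6) sum_nonpos[of I "\<lambda>i. spending (q i) (w i) (p i) a b"] by (meson leD leI)
  have "t * spending (q i) (w i) (p i) a b \<le> spending (q i) (w i) (p i) (t * a) (t * b)"
    if i: "i \<in> I" for i
  proof (cases "spending (q i) (w i) (p i) a b > 0")
    case True
    then show ?thesis using assms i by (intro less_imp_le spending_superhom) auto
  next
    case False
    then have "spending (q i) (w i) (p i) a b = 0"
      using spending_nonneg[of "q i" "w i" "p i" a b] assms(2)[OF i] by auto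
    then show ?thesis using spending_nonneg[of "q i" "w i"] assms(2)[OF i] by simp
  qed
  then show ?thesis unfolding sum_distrib_left using assms j
    by (intro sum_strict_mono_strong[of I j]) (auto intro: spending_superhom)
qed

lemma spending_equilibrium_exists:
  fixes q w p :: "'a \<Rightarrow> real" and X Y :: real
  assumes I: "finite I" "I \<noteq> {}" and qw: "\<And>i. i \<in> I \<Longrightarrow> q i > 0 \<and> w i > 0"
    and XY: "X > 0" "Y > 0"
  shows "\<exists>a b. a > 0 \<and> b > 0 \<and> (\<Sum>i\<in>I. spending (q i) (w i) (p i) a b) = X * a \<and>
    (\<Sum>i\<in>I. spending (1 / q i) (w i) (- p i / q i) b a) = Y * b"
proof (rule quadrant_zero)
  have qw': "1 / q i > 0 \<and> w i > 0" if "i \<in> I" for i using qw[OF that] by simp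
  show "continuous_on UNIV (\<lambda>z. \<Sum>i\<in>I. spending (q i) (w i) (p i) (fst z) (snd z))"
    "continuous_on UNIV (\<lambda>z. \<Sum>i\<in>I. spending (1 / q i) (w i) (- p i / q i) (fst z) (snd z))"
    by (intro continuous_on_sum continuous_on_spending)+
  show "(\<Sum>i\<in>I. q i * w i / 2) > 0" "(\<Sum>i\<in>I. 1 / q i * w i / 2) > 0"
    using I qw by (auto intro!: sum_pos)
  show "(\<Sum>i\<in>I. spending (q i) (w i) (p i) a b) \<le> (\<Sum>i\<in>I. q i * w i / 2) * b\<^sup>2" for a b
    unfolding sum_distrib_right using qw by (intro sum_mono spending_le) auto
  show "(\<Sum>i\<in>I. spending (1 / q i) (w i) (- p i / q i) a b) \<le> (\<Sum>i\<in>I. 1 / q i * w i / 2) * b\<^sup>2" for a b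
    unfolding sum_distrib_right using qw' by (intro sum_mono spending_le) auto
  show "(\<Sum>i\<in>I. spending (q i) (w i) (p i) a b) \<le> (\<Sum>i\<in>I. spending (q i) (w i) (p i) a b')"
    if "b \<le> b'" for a b b' using qw that by (intro sum_mono spending_mono) auto
  show "(\<Sum>i\<in>I. spending (1 / q i) (w i) (- p i / q i) a b) \<le>
      (\<Sum>i\<in>I. spending (1 / q i) (w i) (- p i / q i) a b')"
    if "b \<le> b'" for a b b' using qw' that by (intro sum_mono spending_mono) auto
  show "t * (\<Sum>i\<in>I. spending (q i) (w i) (p i) a b) <
      (\<Sum>i\<in>I. spending (q i) (w i) (p i) (t * a) (t * b))"
    if "a > 0" "b > 0" "t > 1" "0 < (\<Sum>i\<in>I. spending (q i) (w i) (p i) a b)" for a b t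
    using that qw I by (intro sum_spending_superhom) auto
  show "t * (\<Sum>i\<in>I. spending (1 / q i) (w i) (- p i / q i) a b) <
      (\<Sum>i\<in>I. spending (1 / q i) (w i) (- p i / q i) (t * a) (t * b))"
    if "a > 0" "b > 0" "t > 1" "0 < (\<Sum>i\<in>I. spending (1 / q i) (w i) (- p i / q i) a b)" for a b t
    using that qw' I by (intro sum_spending_superhom) auto
  show "\<exists>t>0. X * (t * a) < (\<Sum>i\<in>I. spending (q i) (w i) (p i) (t * a) (t * b))"
    if "a > 0" "b > 0" for a b
    using sum_spending_unbounded[of I q w a b "X * a" p] qw I that by (simp add: mult_ac)
  show "\<exists>t>0. Y * (t * a) < (\<Sum>i\<in>I. spending (1 / q i) (w i) (- p i / q i) (t * a) (t * b))"
    if "a > 0" "b > 0" for a b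
    using sum_spending_unbounded[of I "\<lambda>i. 1 / q i" w a b "Y * a" "\<lambda>i. - p i / q i"] qw' I that
    by (simp add: mult_ac)
qed (use XY in auto)

section \<open>The equations for \<open>gA\<close> and \<open>gB\<close> in terms of
  spending\<close>

lemma spending_swap:
  assumes "q > 0" "w > 0"
  shows "spending (1 / q) w (- p / q) b a =
    ((max (blotto_h q w p a b - p) (max 0 (- p)))\<^sup>2 - (max 0 (- p))\<^sup>2) / (2 * q * w)"
proof -
  let ?h = "blotto_h q w p a b"
  have max_eqs: "max ((?h - p) / q) (max 0 (- p) / q) = max (?h - p) (max 0 (- p)) / q"
    "max 0 (- p / q) = max 0 (- p) / q"
    using assms by (simp_all add: max_divide_distrib_right)
  have "((A / q)\<^sup>2 - (B / q)\<^sup>2) / (2 * (1 / q) * w) = (A\<^sup>2 - B\<^sup>2) / (2 * q * w)" for A B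
    using assms by (simp add: field_simps power2_eq_square)
  then show ?thesis unfolding spending_def blotto_h_swap[OF assms(1)] max_eqs .
qed

text \<open>\<open>I_plus\<close> and \<open>I_minus\<close> together are exactly the battlefields
  with \<open>h > max 0 p\<close>, where the truncation in \<open>spending\<close> is inactive;
  elsewhere \<open>spending\<close> is 0. The sign of \<open>p\<close> decides whether
  \<open>p\<^sup>2\<close> is subtracted.\<close>

lemma sum_spending_gA:
  assumes "\<And>i. i \<in> battlefields G \<Longrightarrow> wt G i > 0 \<and> eff G i > 0" "a > 0" "b > 0"
  shows "gA G a b = (\<Sum>i\<in>battlefields G. spending (eff G i) (wt G i) (pre G i) a b) - budgetB G * a"
proof -
  let ?h = "h_min G a b"
  let ?f = "\<lambda>i. ((?h i)\<^sup>2 - (pre G i)\<^sup>2) / (2 * eff G i * wt G i)"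
  let ?g = "\<lambda>i. (?h i)\<^sup>2 / (2 * eff G i * wt G i)"
  have "(\<Sum>i\<in>I_plus G b. ?f i) + (\<Sum>i\<in>I_minus G a. ?g i) =
    (\<Sum>i\<in>battlefields G. (if i \<in> I_plus G b then ?f i else 0) + (if i \<in> I_minus G a then ?g i else 0))"
    unfolding sum.distrib
    by (intro arg_cong2[where f = "(+)"] sum.mono_neutral_cong_left) (auto simp: I_plus_def I_minus_def)
  also have "\<dots> = (\<Sum>i\<in>battlefields G. spending (eff G i) (wt G i) (pre G i) a b)"
  proof (intro sum.cong refl)
    fix i assume i: "i \<in> battlefields G"
    have pl: "i \<in> I_plus G b \<longleftrightarrow> pre G i \<ge> 0 \<and> ?h i > pre G i"
      using i assms(1)[OF i] assms(2) by (auto simp: I_plus_def h_min_def field_simps)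
    have mi: "i \<in> I_minus G a \<longleftrightarrow> pre G i < 0 \<and> ?h i > 0"
      using i assms(1)[OF i] assms(3) by (auto simp: I_minus_def h_min_def field_simps)
    show "(if i \<in> I_plus G b then ?f i else 0) + (if i \<in> I_minus G a then ?g i else 0) =
      spending (eff G i) (wt G i) (pre G i) a b"
      unfolding pl mi by (auto simp: spending_def blotto_h_def h_min_def[symmetric] max_def)
  qed
  finally show ?thesis by (simp add: gA_def)
qed

lemma sum_spending_gB:
  assumes "\<And>i. i \<in> battlefields G \<Longrightarrow> wt G i > 0 \<and> eff G i > 0" "a > 0" "b > 0"
  shows "gB G a b =
    (\<Sum>i\<in>battlefields G. spending (1 / eff G i) (wt G i) (- pre G i / eff G i) b a) - budgetA G * b"
proof -
  let ?h = "h_min G a b"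
  let ?f = "\<lambda>i. (?h i - pre G i)\<^sup>2 / (2 * eff G i * wt G i)"
  let ?g = "\<lambda>i. ((?h i - pre G i)\<^sup>2 - (pre G i)\<^sup>2) / (2 * eff G i * wt G i)"
  have "(\<Sum>i\<in>I_plus G b. ?f i) + (\<Sum>i\<in>I_minus G a. ?g i) =
    (\<Sum>i\<in>battlefields G. (if i \<in> I_plus G b then ?f i else 0) + (if i \<in> I_minus G a then ?g i else 0))"
    unfolding sum.distrib
    by (intro arg_cong2[where f = "(+)"] sum.mono_neutral_cong_left) (auto simp: I_plus_def I_minus_def)
  also have "\<dots> = (\<Sum>i\<in>battlefields G. spending (1 / eff G i) (wt G i) (- pre G i / eff G i) b a)"
  proof (intro sum.cong refl)
    fix i assume i: "i \<in> battlefields G"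
    let ?q = "eff G i" and ?w = "wt G i" and ?p = "pre G i"
    have q: "?q > 0" "?w > 0" using assms(1)[OF i] by auto
    have pl: "i \<in> I_plus G b \<longleftrightarrow> ?p \<ge> 0 \<and> ?h i > ?p"
      using i q assms(2) by (auto simp: I_plus_def h_min_def field_simps)
    have mi: "i \<in> I_minus G a \<longleftrightarrow> ?p < 0 \<and> ?h i > 0"
      using i q assms(3) by (auto simp: I_minus_def h_min_def field_simps)
    have "spending (1 / ?q) ?w (- ?p / ?q) b a =
      ((max (?h i - ?p) (max 0 (- ?p)))\<^sup>2 - (max 0 (- ?p))\<^sup>2) / (2 * ?q * ?w)"
      using spending_swap[OF q] by (simp add: blotto_h_def h_min_def)
    then show "(if i \<in> I_plus G b then ?f i else 0) + (if i \<in> I_minus G a then ?g i else 0) =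
      spending (1 / ?q) ?w (- ?p / ?q) b a"
      unfolding pl mi by (auto simp: max_def)
  qed
  finally show ?thesis by (simp add: gB_def)
qed

section \<open>Threshold distributions\<close>

text \<open>All distributions in question have tail \<open>max 0 (m - max x c) / s\<close> on the nonnegative reals. Such
  a law is the image of the uniform distribution under a truncated affine map.\<close>

definition threshold_cdf :: "real \<Rightarrow> real \<Rightarrow> real \<Rightarrow> real \<Rightarrow> real" where
  "threshold_cdf m s c x = (if x < 0 then 0 else 1 - max 0 (m - max x c) / s)"

text \<open>The variable \<open>u\<close> measures upper tail mass, so the map decreases on the unit
  interval. Mass left once the affine part has come down to \<open>max 0 c\<close> goes into an atom
  at 0.\<close>

definition threshold_quantile :: "real \<Rightarrow> real \<Rightarrow> real \<Rightarrow> real \<Rightarrow> real" where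
  "threshold_quantile m s c u = (if s * u < m - max 0 c then m - s * u else 0)"

abbreviation unit_uniform :: "real measure" where
  "unit_uniform \<equiv> restrict_space lborel {0..1}"

lemma prob_space_unit_uniform: "prob_space unit_uniform"
  by (intro prob_spaceI) (simp add: emeasure_restrict_space space_restrict_space)

lemma borel_measurable_threshold_quantile [measurable]:
  "threshold_quantile m s c \<in> borel_measurable borel"
  unfolding threshold_quantile_def by measurable

context
  fixes m s c :: real
  assumes s: "s > 0" and ms: "m - max 0 c \<le> s"
begin

interpretation U: prob_space unit_uniform by (rule prob_space_unit_uniform)

lemma quantile_measurable_unit: "threshold_quantile m s c \<in> borel_measurable unit_uniform"
  by (intro measurable_restrict_space1) measurable

lemma quantile_bounds:
  assumes "0 \<le> u"
  shows "0 \<le> threshold_quantile m s c u" "threshold_quantile m s c u \<le> \<bar>m\<bar>"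
proof -
  have "0 \<le> s * u" using s assms by simp
  then show "0 \<le> threshold_quantile m s c u" "threshold_quantile m s c u \<le> \<bar>m\<bar>"
    by (auto simp: threshold_quantile_def)
qed

text \<open>For \<open>x \<ge> 0\<close>, the value is at most \<open>x\<close> exactly when
  \<open>u\<close> is at least the tail \<open>?L\<close>. No value lies strictly between 0 and
  \<open>max 0 c\<close>, whence the flat piece of the cdf.\<close>

lemma cdf_quantile: "cdf (distr unit_uniform borel (threshold_quantile m s c)) = threshold_cdf m s c"
proof
  fix x :: real
  let ?X = "threshold_quantile m s c"
  let ?L = "max 0 (m - max x c) / s"
  have "cdf (distr unit_uniform borel ?X) x = measure unit_uniform {u \<in> {0..1}. ?X u \<le> x}"
    using quantile_measurable_unit unfolding cdf_def
    by (subst measure_distr) (auto simp: space_restrict_space intro!: arg_cong2[where f = measure])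
  also have "\<dots> = threshold_cdf m s c x"
  proof (cases "x < 0")
    case True
    then have "{u \<in> {0..1}. ?X u \<le> x} = {}" using quantile_bounds by force
    with True show ?thesis by (simp only: measure_empty) (simp add: threshold_cdf_def)
  next
    case False
    have "?X u \<le> x \<longleftrightarrow> ?L \<le> u" if "0 \<le> u" for u
    proof -
      have "?X u \<le> x \<longleftrightarrow> m - max x c \<le> s * u"
        using False mult_nonneg_nonneg[of s u] s that
        by (auto simp: threshold_quantile_def max_def split: if_splits)
      also have "\<dots> \<longleftrightarrow> max 0 (m - max x c) \<le> s * u"
        using mult_nonneg_nonneg[of s u] s that by auto
      finally show ?thesis using s by (simp add: field_simps)
    qed
    \<comment> \<open>The hypothesis \<open>ms\<close> bounds the tail by 1, so that the event is an
      interval inside the unit interval.\<close>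
    moreover have L: "0 \<le> ?L" "?L \<le> 1" using s ms False by (auto simp: field_simps max_def split: if_splits)
    ultimately have "{u \<in> {0..1}. ?X u \<le> x} = {?L..1}" by auto
    then show ?thesis using L False
      by (simp add: measure_restrict_space threshold_cdf_def)
  qed
  finally show "cdf (distr unit_uniform borel ?X) x = threshold_cdf m s c x" .
qed

lemma real_distribution_quantile:
  "real_distribution (distr unit_uniform borel (threshold_quantile m s c))"
  using quantile_measurable_unit by (rule U.real_distribution_distr)

lemma distribution_function_threshold: "distribution_function (threshold_cdf m s c)"
proof -
  interpret D: real_distribution "distr unit_uniform borel (threshold_quantile m s c)"
    by (rule real_distribution_quantile)
  show ?thesis
    unfolding distribution_function_def cdf_quantile[symmetric]
    by (intro conjI allI monoI D.cdf_nondecreasing D.cdf_is_right_cont D.cdf_lim_at_bot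
          D.cdf_lim_at_top_prob)
qed

lemma interval_measure_threshold:
  "interval_measure (threshold_cdf m s c) = distr unit_uniform borel (threshold_quantile m s c)"
  using distribution_function_threshold
  by (intro cdf_unique real_distribution_interval_measure real_distribution_quantile)
     (auto simp: distribution_function_def mono_def cdf_quantile cdf_interval_measure)

lemma measure_threshold_Iic: "measure (interval_measure (threshold_cdf m s c)) {..x} = threshold_cdf m s c x"
  unfolding interval_measure_threshold using cdf_quantile by (auto simp: cdf_def fun_eq_iff)

lemma AE_threshold_nonneg: "AE x in interval_measure (threshold_cdf m s c). x \<ge> 0"
  unfolding interval_measure_threshold using quantile_measurable_unit quantile_bounds
  by (subst AE_distr_iff) (auto simp: space_restrict_space)

lemma msupport_threshold: "msupport (interval_measure (threshold_cdf m s c)) \<subseteq> {0..}"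
proof
  fix x assume x: "x \<in> msupport (interval_measure (threshold_cdf m s c))"
  have "emeasure (interval_measure (threshold_cdf m s c)) {..<0} = 0"
    using AE_threshold_nonneg by (subst (asm) AE_iff_measurable[of "{..<0}"]) auto
  with x show "x \<in> {0..}"
    unfolding msupport_def by (auto simp: not_le dest!: spec[of _ "{..<0}"])
qed

lemma integrable_threshold: "integrable (interval_measure (threshold_cdf m s c)) (\<lambda>x. x)"
  unfolding interval_measure_threshold using quantile_measurable_unit
  by (subst integrable_distr_eq)
     (auto intro!: U.integrable_const_bound[where B = "\<bar>m\<bar>"] simp: space_restrict_space quantile_bounds)

lemma mean_threshold_le:
  "(\<integral>x. x \<partial>interval_measure (threshold_cdf m s c)) \<le> ((max m (max 0 c))\<^sup>2 - (max 0 c)\<^sup>2) / (2 * s)"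
proof -
  let ?X = "threshold_quantile m s c" and ?d = "max 0 c"
  have mean: "(\<integral>x. x \<partial>interval_measure (threshold_cdf m s c)) = (\<integral>u. indicator {0..1} u *\<^sub>R ?X u \<partial>lborel)"
    unfolding interval_measure_threshold using quantile_measurable_unit
    by (simp add: integral_distr integral_restrict_space)
  show ?thesis
  proof (cases "m \<le> ?d")
    case True
    have "indicator {0..1} u *\<^sub>R ?X u = 0" for u
    proof (cases "0 \<le> u")
      case u: True
      then have "0 \<le> s * u" using s by simp
      with True show ?thesis by (simp add: threshold_quantile_def)
    qed simp
    then have "(\<integral>u. indicator {0..1} u *\<^sub>R ?X u \<partial>lborel) = 0" by (simp only: integral_zero)
    with True show ?thesis unfolding mean by (simp add: max_absorb2)
  next
    case False
    define L where "L = (m - ?d) / s"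
    have "?d < m" using False by (simp only: not_le)
    then have L: "0 \<le> L" unfolding L_def using s by (intro divide_nonneg_pos) (simp_all only: diff_ge_0_iff_ge less_imp_le)
    let ?f = "\<lambda>u. (m - s * u) * indicator {0..L} u"
    have FTC: "has_bochner_integral lborel ?f ((m * L - s * L\<^sup>2 / 2) - (m * 0 - s * 0\<^sup>2 / 2))"
      using L by (intro has_bochner_integral_FTC_Icc_real) (auto intro!: derivative_eq_intros)
    \<comment> \<open>The integrands can differ only at \<open>u = L\<close>, where the quantile is
      already 0; a pointwise inequality avoids an argument about null sets.\<close>
    have "(\<integral>u. indicator {0..1} u *\<^sub>R ?X u \<partial>lborel) \<le> (\<integral>u. ?f u \<partial>lborel)"
    proof (rule integral_mono)
      show "integrable lborel (\<lambda>u. indicator {0..1} u *\<^sub>R ?X u)"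
        using integrable_threshold quantile_measurable_unit unfolding interval_measure_threshold
        by (simp add: integrable_distr_eq integrable_restrict_space)
      show "integrable lborel ?f" using FTC by (simp add: has_bochner_integral_iff)
      fix u :: real
      have "u \<le> L \<longleftrightarrow> s * u \<le> m - ?d"
        using s by (simp add: L_def field_simps)
      then show "indicator {0..1} u *\<^sub>R ?X u \<le> ?f u"
        by (auto simp: threshold_quantile_def indicator_def)
    qed
    also have "\<dots> = m * L - s * L\<^sup>2 / 2"
      using FTC by (simp add: has_bochner_integral_iff)
    also have "\<dots> = (m\<^sup>2 - ?d\<^sup>2) / (2 * s)"
      using s unfolding L_def by (simp add: field_simps power2_eq_square)
    finally have "(\<integral>u. indicator {0..1} u *\<^sub>R ?X u \<partial>lborel) \<le> (m\<^sup>2 - ?d\<^sup>2) / (2 * s)" .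
    moreover have "max m ?d = m" using False by (intro max_absorb1) (meson linear)
    ultimately show ?thesis unfolding mean by (simp only:)
  qed
qed

end

text \<open>Here \<open>f\<close> will be the outcome on one battlefield against a fixed opposing
  allocation. Whatever the tie parameter, it is at most the indicator of a win or tie, so a value of
  the cdf bounds its expectation.\<close>

lemma expectation_le_threshold:
  fixes M :: "(nat \<Rightarrow> real) measure" and f :: "real \<Rightarrow> real"
  assumes "prob_space M" "sets M = sets (PiM I (\<lambda>_. borel))" "i \<in> I"
    and distr: "distr M borel (\<lambda>x. x i) = interval_measure (threshold_cdf m s c)"
    and ms: "s > 0" "m - max 0 c \<le> s"
    and f: "\<And>x. 0 \<le> f x" "\<And>x. f x \<le> indicator {..t} x" "f \<in> borel_measurable borel"
  shows "integrable M (\<lambda>x. f (x i))" "(\<integral>x. f (x i) \<partial>M) \<le> threshold_cdf m s c t"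
proof -
  interpret prob_space M by fact
  have [measurable]: "(\<lambda>x. x i) \<in> borel_measurable M" "f \<in> borel_measurable borel"
    using assms by (auto simp: measurable_cong_sets[OF assms(2) refl])
  have f1: "f x \<le> 1" for x using f(2)[of x] indicator_le_1 by (rule order_trans)
  show int: "integrable M (\<lambda>x. f (x i))"
    by (rule integrable_const_bound[where B = 1]) (use f(1) f1 in auto)
  have "(\<integral>x. f (x i) \<partial>M) \<le> (\<integral>x. indicator {..t} (x i) \<partial>M)"
    using f by (intro integral_mono[OF int] integrable_const_bound[where B = 1]) auto
  also have "\<dots> = (\<integral>x. indicator {..t} x \<partial>distr M borel (\<lambda>x. x i))"
    by (subst integral_distr) auto
  also have "\<dots> = threshold_cdf m s c t"
    unfolding distr using measure_threshold_Iic[OF ms] by simp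
  finally show "(\<integral>x. f (x i) \<partial>M) \<le> threshold_cdf m s c t" .
qed

section \<open>A single battlefield\<close>

text \<open>This is the law of player B; exchanging the players yields that of player A, so one
  family serves both.\<close>

definition blotto_cdf :: "real \<Rightarrow> real \<Rightarrow> real \<Rightarrow> real \<Rightarrow> real \<Rightarrow> real \<Rightarrow> real" where
  "blotto_cdf q w p a b = threshold_cdf (blotto_h q w p a b / q) (w * a / q) (p / q)"

lemma blotto_cdf_eq:
  assumes "q > 0" "x \<ge> 0"
  shows "blotto_cdf q w p a b x = 1 - max 0 (blotto_h q w p a b - max (q * x) p) / (w * a)"
proof -
  let ?h = "blotto_h q w p a b"
  have "max x (p / q) = max (q * x) p / q"
    using assms by (simp add: max_divide_distrib_right)
  then have "?h / q - max x (p / q) = (?h - max (q * x) p) / q"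
    by (simp add: diff_divide_distrib)
  moreover have "max 0 ((?h - max (q * x) p) / q) = max 0 (?h - max (q * x) p) / q"
    using assms by (simp add: max_divide_distrib_right)
  ultimately show ?thesis
    using assms by (simp add: blotto_cdf_def threshold_cdf_def)
qed

lemma blotto_cdf_swap_eq:
  assumes "q > 0" "x \<ge> 0"
  shows "blotto_cdf (1 / q) w (- p / q) b a x =
    1 - max 0 (blotto_h q w p a b - max (x + p) 0) / (q * w * b)"
proof -
  let ?h = "blotto_h q w p a b"
  have "max (1 / q * x) (- p / q) = max x (- p) / q"
    using assms by (simp add: max_divide_distrib_right)
  moreover have "max x (- p) = max (x + p) 0 - p" by (simp add: max_def)
  ultimately have "(?h - p) / q - max (1 / q * x) (- p / q) = (?h - max (x + p) 0) / q"
    by (simp add: diff_divide_distrib)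
  moreover have "max 0 ((?h - max (x + p) 0) / q) = max 0 (?h - max (x + p) 0) / q"
    using assms by (simp add: max_divide_distrib_right)
  moreover have "blotto_cdf (1 / q) w (- p / q) b a x =
      1 - max 0 ((?h - p) / q - max (1 / q * x) (- p / q)) / (w * b)"
    using assms by (subst blotto_cdf_eq) (auto simp only: blotto_h_swap zero_less_divide_1_iff)
  ultimately show ?thesis by (simp only:) (simp add: mult_ac)
qed

text \<open>With \<open>u = w * a\<close>, \<open>v = q * w * b\<close> and
  \<open>z = q * x\<close>, the case table of \<open>distB\<close> consists of the affine pieces of
  a single truncated formula. The companion for player A uses \<open>x\<close> unscaled.\<close>

lemma threshold_casesB:
  fixes u v z p :: real
  assumes "u > 0" "v > 0" "z \<ge> 0"
  shows "(if p \<ge> 0 then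
       (if v - p \<le> 0 then 1
        else if v - p \<le> u then (if z < p then 1 - v / u + p / u else if z \<le> v then 1 - v / u + z / u else 1)
        else (if z < p then 0 else if z \<le> u + p then (z - p) / u else 1))
     else
       (if u \<le> - p then 1
        else if u \<le> v - p then (if z \<le> u + p then (z - p) / u else 1)
        else (if z \<le> v then 1 - v / u + z / u else 1))) =
    1 - max 0 (min v (u + p) - max z p) / u"
  using assms by (auto simp: min_def max_def divide_simps)

lemma threshold_casesA:
  fixes u v x p :: real
  assumes "u > 0" "v > 0" "x \<ge> 0"
  shows "(if p \<ge> 0 then
       (if v - p \<le> 0 then 1
        else if v - p \<le> u then (if x \<le> v - p then (p + x) / v else 1)
        else (if x \<le> u then 1 - u / v + x / v else 1))
     else
       (if u \<le> - p then 1
        else if u \<le> v - p then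
          (if x < - p then 1 - u / v - p / v else if x \<le> u then 1 - u / v + x / v else 1)
        else (if x < - p then 0 else if x \<le> v - p then (p + x) / v else 1))) =
    1 - max 0 (min v (u + p) - max (x + p) 0) / v"
  using assms by (auto simp: min_def max_def divide_simps)

lemma distB_eq_blotto_cdf:
  assumes "wt G i > 0" "eff G i > 0" "a > 0" "b > 0"
  shows "distB G a b i = blotto_cdf (eff G i) (wt G i) (pre G i) a b"
proof
  fix x
  define q w p where qwp: "q = eff G i" "w = wt G i" "p = pre G i"
  have pos: "w > 0" "q > 0" "a > 0" "b > 0" using assms by (simp_all add: qwp)
  have "distB G a b i x = blotto_cdf q w p a b x"
  proof (cases "x < 0")
    case False
    have cmp: "x < p / q \<longleftrightarrow> q * x < p" "x \<le> w * b \<longleftrightarrow> q * x \<le> q * w * b"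
      "x \<le> (w * a + p) / q \<longleftrightarrow> q * x \<le> w * a + p"
      using pos by (simp_all add: field_simps)
    have "q * x \<ge> 0" "w * a > 0" "q * w * b > 0" using False pos by simp_all
    note cases = threshold_casesB[OF this(2,3,1), of p]
    have "x \<ge> 0" using False by simp
    moreover have "q * b / a = (q * w * b) / (w * a)" using pos by simp
    ultimately show ?thesis
      using False pos cases
      by (simp only: distB_def Let_def qwp[symmetric] cmp blotto_cdf_eq blotto_h_def if_False)
  qed (simp add: distB_def blotto_cdf_def threshold_cdf_def)
  then show "distB G a b i x = blotto_cdf (eff G i) (wt G i) (pre G i) a b x"
    by (simp only: qwp)
qed

lemma distA_eq_blotto_cdf:
  assumes "wt G i > 0" "eff G i > 0" "a > 0" "b > 0"
  shows "distA G a b i = blotto_cdf (1 / eff G i) (wt G i) (- pre G i / eff G i) b a"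
proof
  fix x
  define q w p where qwp: "q = eff G i" "w = wt G i" "p = pre G i"
  have pos: "w > 0" "q > 0" "a > 0" "b > 0" using assms by (simp_all add: qwp)
  have "distA G a b i x = blotto_cdf (1 / q) w (- p / q) b a x"
  proof (cases "x < 0")
    case False
    then have x: "x \<ge> 0" by simp
    have "w * a > 0" "q * w * b > 0" using pos by simp_all
    note cases = threshold_casesA[OF this x, of p]
    have "a / (q * b) = (w * a) / (q * w * b)" using pos by simp
    then show ?thesis
      using False pos cases
      by (simp only: distA_def Let_def qwp[symmetric] blotto_cdf_swap_eq if_False x blotto_h_def)
  qed (simp add: distA_def blotto_cdf_def threshold_cdf_def)
  then show "distA G a b i x = blotto_cdf (1 / eff G i) (wt G i) (- pre G i / eff G i) b a x"
    by (simp only: qwp)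
qed

section \<open>Affine bound and value identity on one battlefield\<close>

context
  fixes q w p a b :: real
  assumes pos: "q > 0" "w > 0" "a > 0" "b > 0"
begin

lemma blotto_threshold: "w * a / q > 0" "blotto_h q w p a b / q - max 0 (p / q) \<le> w * a / q"
proof -
  have "(blotto_h q w p a b - max 0 p) / q \<le> w * a / q"
    using pos by (intro divide_right_mono) (auto simp: blotto_h_def)
  moreover have "max 0 (p / q) = max 0 p / q" using pos by (simp add: max_divide_distrib_right)
  ultimately show "blotto_h q w p a b / q - max 0 (p / q) \<le> w * a / q"
    by (simp add: diff_divide_distrib)
qed (use pos in simp)

lemma mean_blotto_cdf_le:
  "(\<integral>x. x \<partial>interval_measure (blotto_cdf q w p a b)) \<le> spending q w p a b / a"
proof -
  have e1: "max 0 (p / q) = max 0 p / q"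
    and e2: "max (blotto_h q w p a b / q) (max 0 p / q) = max (blotto_h q w p a b) (max 0 p) / q"
    using pos by (simp_all add: max_divide_distrib_right)
  have "((A / q)\<^sup>2 - (B / q)\<^sup>2) / (2 * (w * a / q)) = (A\<^sup>2 - B\<^sup>2) / (2 * q * w) / a" for A B
    using pos by (simp add: field_simps power2_eq_square)
  then show ?thesis
    using mean_threshold_le[OF blotto_threshold] unfolding e1 e2 blotto_cdf_def spending_def by simp
qed

text \<open>The allocation \<open>x\<close> of player A wins or ties exactly against allocations up
  to \<open>(x + p) / q\<close>. The weighted tail falls at rate at most \<open>1 / a\<close> in
  \<open>x\<close>, so \<open>1 / a\<close> acts as the price of a unit of budget.\<close>

lemma blotto_cdf_le:
  assumes "x \<ge> 0"
  shows "w * blotto_cdf q w p a b ((x + p) / q) \<le> w - max 0 (blotto_h q w p a b - p) / a + x / a"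
proof -
  let ?h = "blotto_h q w p a b"
  have h: "?h - p \<le> w * a" by (simp add: blotto_h_def)
  have wa: "max 0 (?h - p) / a \<le> w" using h pos by (simp add: field_simps max_def)
  show ?thesis
  proof (cases "x + p < 0")
    \<comment> \<open>The cdf vanishes at a negative argument, and the affine bound is nonnegative
      because \<open>?h - p \<le> w * a\<close>.\<close>
    case True
    then show ?thesis using wa assms pos
      by (simp add: blotto_cdf_def threshold_cdf_def divide_less_0_iff)
  next
    case False
    have "max ((x + p) / q) (p / q) = (x + p) / q"
      using assms pos by (intro max_absorb1 divide_right_mono) auto
    then have "w * blotto_cdf q w p a b ((x + p) / q) = w - w * (max 0 (?h / q - (x + p) / q) / (w * a / q))"
      using False pos by (simp add: blotto_cdf_def threshold_cdf_def divide_less_0_iff right_diff_distrib)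
    also have "?h / q - (x + p) / q = (?h - p - x) / q" by (simp add: diff_divide_distrib add_divide_distrib)
    also have "max 0 \<dots> = max 0 (?h - p - x) / q" using pos by (simp add: max_divide_distrib_right)
    also have "w * (max 0 (?h - p - x) / q / (w * a / q)) = max 0 (?h - p - x) / a"
      using pos by (simp add: field_simps)
    also have "w - max 0 (?h - p - x) / a \<le> w - max 0 (?h - p) / a + x / a"
    proof -
      have "max 0 (?h - p) \<le> max 0 (?h - p - x) + x" using assms by auto
      then have "max 0 (?h - p) / a \<le> (max 0 (?h - p - x) + x) / a"
        using pos by (intro divide_right_mono) auto
      then show ?thesis by (simp add: add_divide_distrib)
    qed
    finally show ?thesis .
  qed
qed

text \<open>This is complementary slackness. In the contested case the defect is a multiple of
  \<open>(w * a - (h - p)) * (q * w * b - h)\<close>, which vanishes since \<open>h\<close> is the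
  minimum of \<open>q * w * b\<close> and \<open>w * a + p\<close>. Otherwise nothing is spent and
  the favored player is credited with all of \<open>w\<close>.\<close>

lemma battlefield_value:
  defines "h \<equiv> blotto_h q w p a b"
  shows "(w - max 0 (h - p) / a) + (w - max 0 h / (q * b)) +
    (spending q w p a b + spending (1 / q) w (- p / q) b a) / (a * b) = w"
proof (cases "max 0 p < h")
  case True
  then have hp: "0 < h" "p < h" by auto
  then have "spending q w p a b = (h\<^sup>2 - (max 0 p)\<^sup>2) / (2 * q * w)"
    unfolding spending_def h_def[symmetric] by (simp add: max_absorb1)
  moreover have "max (h - p) (max 0 (- p)) = h - p" using hp by simp
  then have "spending (1 / q) w (- p / q) b a = ((h - p)\<^sup>2 - (max 0 (- p))\<^sup>2) / (2 * q * w)"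
    unfolding spending_swap[OF pos(1,2)] h_def[symmetric] by simp
  moreover have "(h\<^sup>2 - (max 0 p)\<^sup>2) + ((h - p)\<^sup>2 - (max 0 (- p))\<^sup>2) = 2 * (h * (h - p))"
    by (simp add: max_def power2_eq_square algebra_simps)
  ultimately have S: "spending q w p a b + spending (1 / q) w (- p / q) b a = h * (h - p) / (q * w)"
    using pos by (simp add: add_divide_distrib[symmetric])
  have "(w - max 0 (h - p) / a) + (w - max 0 h / (q * b)) +
      (spending q w p a b + spending (1 / q) w (- p / q) b a) / (a * b) =
      w + (w * a - (h - p)) * (q * w * b - h) / (q * w * a * b)"
    unfolding S using pos hp by (simp add: field_simps)
  also have "(w * a - (h - p)) * (q * w * b - h) = 0"
    by (auto simp: h_def blotto_h_def min_def)
  finally show ?thesis by simp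
next
  case False
  then have h: "h \<le> max 0 p" by (simp only: not_less)
  then have "spending q w p a b = 0"
    unfolding spending_def h_def[symmetric] by (simp add: max_absorb2)
  moreover have "max (h - p) (max 0 (- p)) = max 0 (- p)" using h by (auto simp: max_def split: if_splits)
  then have "spending (1 / q) w (- p / q) b a = 0"
    unfolding spending_swap[OF pos(1,2)] h_def[symmetric] by simp
  moreover have "(w - max 0 (h - p) / a) + (w - max 0 h / (q * b)) = w"
  proof (cases "p \<ge> 0")
    case True
    have "p < w * a + p" using pos by simp
    with True h have "h = q * w * b" "h \<le> p" by (auto simp: h_def blotto_h_def min_def split: if_splits)
    with pos show ?thesis by simp
  next
    case False
    have "0 < q * w * b" using pos by simp
    with False h have "h = w * a + p" "h \<le> 0" by (auto simp: h_def blotto_h_def min_def split: if_splits)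
    with pos show ?thesis by simp
  qed
  ultimately show ?thesis by simp
qed

end

section \<open>Optimality\<close>

lemma borel_measurable_blotto_beta [measurable]:
  assumes [measurable]: "f \<in> borel_measurable M" "g \<in> borel_measurable M"
  shows "(\<lambda>x. blotto_beta c (f x) (g x)) \<in> borel_measurable M"
  unfolding blotto_beta_def by measurable

lemma payoff_sum: "payoffA G x y + payoffB G x y = (\<Sum>i\<in>battlefields G. wt G i)"
  by (simp add: payoffA_def payoffB_def sum.distrib[symmetric] distrib_left[symmetric])

lemma random_allocation_coordinate:
  assumes M: "random_allocation G F M" and i: "i \<in> battlefields G"
    and F: "F i = blotto_cdf q w p a b" and pos: "q > 0" "w > 0" "a > 0" "b > 0"
  shows "(\<lambda>x. x i) \<in> borel_measurable M" "AE x in M. x i \<ge> 0" "integrable M (\<lambda>x. x i)"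
    "(\<integral>x. x i \<partial>M) = (\<integral>x. x \<partial>interval_measure (F i))"
proof -
  have sets: "sets M = sets (PiM (battlefields G) (\<lambda>_. borel))"
    and distr: "distr M borel (\<lambda>x. x i) = interval_measure (F i)"
    using M i by (auto simp: random_allocation_def)
  show meas: "(\<lambda>x. x i) \<in> borel_measurable M"
    using i by (simp add: measurable_cong_sets[OF sets refl])
  have "AE x in distr M borel (\<lambda>x. x i). x \<ge> 0"
    unfolding distr F blotto_cdf_def by (rule AE_threshold_nonneg[OF blotto_threshold[OF pos]])
  then show "AE x in M. x i \<ge> 0" by (rule AE_distrD[OF meas])
  show "integrable M (\<lambda>x. x i)"
  proof -
    have "integrable (distr M borel (\<lambda>x. x i)) (\<lambda>x. x)"
      unfolding distr F blotto_cdf_def by (rule integrable_threshold[OF blotto_threshold[OF pos]])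
    then show ?thesis by (subst (asm) integrable_distr_eq[OF meas]) auto
  qed
  show "(\<integral>x. x i \<partial>M) = (\<integral>x. x \<partial>interval_measure (F i))"
    unfolding distr[symmetric] by (rule integral_distr[OF meas, symmetric]) simp
qed

lemma expectation_coordinate_le:
  assumes M: "random_allocation G F M" and i: "i \<in> battlefields G"
    and F: "F i = blotto_cdf q w p a b" and pos: "q > 0" "w > 0" "a > 0" "b > 0"
    and f: "\<And>x. 0 \<le> f x" "\<And>x. f x \<le> indicator {..(t + p) / q} x" "f \<in> borel_measurable borel"
    and t: "t \<ge> 0"
  shows "integrable M (\<lambda>x. f (x i))"
    "w * (\<integral>x. f (x i) \<partial>M) \<le> w - max 0 (blotto_h q w p a b - p) / a + t / a"
proof -
  have M': "prob_space M" "sets M = sets (PiM (battlefields G) (\<lambda>_. borel))"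
    and distr: "distr M borel (\<lambda>x. x i) =
      interval_measure (threshold_cdf (blotto_h q w p a b / q) (w * a / q) (p / q))"
    using M i F by (auto simp: random_allocation_def blotto_cdf_def)
  note le = expectation_le_threshold[OF M' i distr blotto_threshold[OF pos] f]
  show "integrable M (\<lambda>x. f (x i))" by (rule le(1))
  have "w * (\<integral>x. f (x i) \<partial>M) \<le> w * blotto_cdf q w p a b ((t + p) / q)"
    unfolding blotto_cdf_def using le(2) pos by (intro mult_left_mono) auto
  also have "\<dots> \<le> w - max 0 (blotto_h q w p a b - p) / a + t / a"
    by (rule blotto_cdf_le[OF pos t])
  finally show "w * (\<integral>x. f (x i) \<partial>M) \<le> w - max 0 (blotto_h q w p a b - p) / a + t / a" .
qed

section \<open>Lagrangian bounds on the payoffs of pure allocations\<close>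

context
  fixes G :: blotto_game and a b :: real
  assumes pos: "\<And>i. i \<in> battlefields G \<Longrightarrow> wt G i > 0 \<and> eff G i > 0" "a > 0" "b > 0"
    and tie: "0 \<le> tie G" "tie G \<le> 1"
begin

text \<open>The intercept of the affine bound in \<open>blotto_cdf_le\<close>: the value credited to
  player A apart from the spending priced at \<open>1 / a\<close>.\<close>

definition lagrangeA :: "nat \<Rightarrow> real" where
  "lagrangeA i = wt G i - max 0 (blotto_h (eff G i) (wt G i) (pre G i) a b - pre G i) / a"

text \<open>The same intercept for exchanged players, where \<open>h - p\<close> turns into
  \<open>h / q\<close>; it is stated with the original \<open>h\<close> to fit
  \<open>battlefield_value\<close>.\<close>

definition lagrangeB :: "nat \<Rightarrow> real" where
  "lagrangeB i = wt G i - max 0 (blotto_h (eff G i) (wt G i) (pre G i) a b) / (eff G i * b)"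

lemma
  assumes "i \<in> battlefields G"
  shows distA_blotto: "distA G a b i = blotto_cdf (1 / eff G i) (wt G i) (- pre G i / eff G i) b a"
    and distB_blotto: "distB G a b i = blotto_cdf (eff G i) (wt G i) (pre G i) a b"
    and wt_pos: "wt G i > 0" and eff_pos: "eff G i > 0" and inv_eff_pos: "1 / eff G i > 0"
  using distA_eq_blotto_cdf distB_eq_blotto_cdf pos(1)[OF assms] pos(2,3) by auto

lemma payoffA_pure_le:
  assumes Q: "random_allocation G (distB G a b) Q" and x: "\<And>i. i \<in> battlefields G \<Longrightarrow> 0 \<le> x i"
  shows "(\<integral>y. payoffA G x y \<partial>Q) \<le> (\<Sum>i\<in>battlefields G. lagrangeA i) + (\<Sum>i\<in>battlefields G. x i) / a"
proof -
  define f where "f i t = blotto_beta (tie G) (x i) (eff G i * t - pre G i)" for i t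
  have f: "0 \<le> f i t" "f i t \<le> indicator {..(x i + pre G i) / eff G i} t" "f i \<in> borel_measurable borel"
    if "i \<in> battlefields G" for i t
  proof -
    show "f i \<in> borel_measurable borel" unfolding f_def[abs_def] by measurable
    have "t \<le> (x i + pre G i) / eff G i \<longleftrightarrow> eff G i * t - pre G i \<le> x i"
      using eff_pos[OF that] by (simp add: field_simps)
    then show "0 \<le> f i t" "f i t \<le> indicator {..(x i + pre G i) / eff G i} t"
      using tie by (auto simp: f_def blotto_beta_def indicator_def)
  qed
  note E = expectation_coordinate_le[OF Q _ distB_blotto eff_pos wt_pos pos(2,3) f x]
  have "(\<integral>y. payoffA G x y \<partial>Q) = (\<Sum>i\<in>battlefields G. wt G i * (\<integral>y. f i (y i) \<partial>Q))"
    unfolding payoffA_def f_def[symmetric] using E(1) by simp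
  also have "\<dots> \<le> (\<Sum>i\<in>battlefields G. lagrangeA i + x i / a)"
    unfolding lagrangeA_def by (intro sum_mono E(2))
  finally show ?thesis by (simp add: sum.distrib sum_divide_distrib)
qed

lemma payoffB_pure_le:
  assumes P: "random_allocation G (distA G a b) P" and y: "\<And>i. i \<in> battlefields G \<Longrightarrow> 0 \<le> y i"
  shows "(\<integral>x. payoffB G x y \<partial>P) \<le> (\<Sum>i\<in>battlefields G. lagrangeB i) + (\<Sum>i\<in>battlefields G. y i) / b"
proof -
  define f where "f i t = 1 - blotto_beta (tie G) t (eff G i * y i - pre G i)" for i t
  have f: "0 \<le> f i t" "f i t \<le> indicator {..(y i + - pre G i / eff G i) / (1 / eff G i)} t"
      "f i \<in> borel_measurable borel"
    if "i \<in> battlefields G" for i t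
  proof -
    show "f i \<in> borel_measurable borel" unfolding f_def[abs_def] by measurable
    have "(y i + - pre G i / eff G i) / (1 / eff G i) = eff G i * y i - pre G i"
      using eff_pos[OF that] by (simp add: field_simps)
    then show "0 \<le> f i t" "f i t \<le> indicator {..(y i + - pre G i / eff G i) / (1 / eff G i)} t"
      using tie by (auto simp: f_def blotto_beta_def indicator_def)
  qed
  note E = expectation_coordinate_le[OF P _ distA_blotto inv_eff_pos wt_pos pos(3,2) f y]
  have lag: "lagrangeB i = wt G i - max 0 (blotto_h (1 / eff G i) (wt G i) (- pre G i / eff G i) b a -
      - pre G i / eff G i) / b" if "i \<in> battlefields G" for i
    using eff_pos[OF that] pos(3) unfolding lagrangeB_def blotto_h_swap[OF eff_pos[OF that]]
    by (simp add: diff_divide_distrib max_divide_distrib_right)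
  have "(\<integral>x. payoffB G x y \<partial>P) = (\<Sum>i\<in>battlefields G. wt G i * (\<integral>x. f i (x i) \<partial>P))"
    unfolding payoffB_def f_def[symmetric] using E(1) by simp
  also have "\<dots> \<le> (\<Sum>i\<in>battlefields G. lagrangeB i + y i / b)"
    using lag E(2) by (intro sum_mono) simp
  finally show ?thesis by (simp add: sum.distrib sum_divide_distrib)
qed

context
  assumes eqA: "gA G a b = 0" and eqB: "gB G a b = 0"
begin

lemma mean_distA_le: "(\<Sum>i\<in>battlefields G. \<integral>x. x \<partial>interval_measure (distA G a b i)) \<le> budgetA G"
proof -
  have "(\<Sum>i\<in>battlefields G. \<integral>x. x \<partial>interval_measure (distA G a b i)) \<le>
      (\<Sum>i\<in>battlefields G. spending (1 / eff G i) (wt G i) (- pre G i / eff G i) b a / b)"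
    using mean_blotto_cdf_le[OF inv_eff_pos wt_pos pos(3,2)] by (intro sum_mono) (simp add: distA_blotto)
  also have "\<dots> = budgetA G"
    using sum_spending_gB[OF pos] eqB pos(3) by (simp add: sum_divide_distrib[symmetric])
  finally show ?thesis .
qed

lemma mean_distB_le: "(\<Sum>i\<in>battlefields G. \<integral>x. x \<partial>interval_measure (distB G a b i)) \<le> budgetB G"
proof -
  have "(\<Sum>i\<in>battlefields G. \<integral>x. x \<partial>interval_measure (distB G a b i)) \<le>
      (\<Sum>i\<in>battlefields G. spending (eff G i) (wt G i) (pre G i) a b / a)"
    using mean_blotto_cdf_le[OF eff_pos wt_pos pos(2,3)] by (intro sum_mono) (simp add: distB_blotto)
  also have "\<dots> = budgetB G"
    using sum_spending_gA[OF pos] eqA pos(2) by (simp add: sum_divide_distrib[symmetric])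
  finally show ?thesis .
qed

text \<open>The two equations replace the budgets by total spending divided by \<open>a\<close> and
  \<open>b\<close>; then \<open>battlefield_value\<close> applies to each summand.\<close>

lemma value_sum:
  "((\<Sum>i\<in>battlefields G. lagrangeA i) + budgetA G / a) + ((\<Sum>i\<in>battlefields G. lagrangeB i) + budgetB G / b) =
    (\<Sum>i\<in>battlefields G. wt G i)"
proof -
  let ?S = "\<lambda>i. spending (eff G i) (wt G i) (pre G i) a b"
    and ?T = "\<lambda>i. spending (1 / eff G i) (wt G i) (- pre G i / eff G i) b a"
  have "budgetB G = (\<Sum>i\<in>battlefields G. ?S i) / a" "budgetA G = (\<Sum>i\<in>battlefields G. ?T i) / b"
    using sum_spending_gA[OF pos] sum_spending_gB[OF pos] eqA eqB pos(2,3) by simp_all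
  then have "budgetA G / a + budgetB G / b = (\<Sum>i\<in>battlefields G. (?S i + ?T i) / (a * b))"
    by (simp add: sum.distrib add_divide_distrib sum_divide_distrib[symmetric] mult.commute)
  moreover have "(\<Sum>i\<in>battlefields G. lagrangeA i + lagrangeB i + (?S i + ?T i) / (a * b)) =
      (\<Sum>i\<in>battlefields G. wt G i)"
    unfolding lagrangeA_def lagrangeB_def
    by (intro sum.cong refl battlefield_value eff_pos wt_pos pos(2,3))
  ultimately show ?thesis by (simp add: sum.distrib)
qed

section \<open>Payoffs under independent randomization\<close>

context
  fixes P Q :: "(nat \<Rightarrow> real) measure"
  assumes P: "random_allocation G (distA G a b) P" and Q: "random_allocation G (distB G a b) Q"
begin

interpretation P: prob_space P using P by (simp add: random_allocation_def)
interpretation Q: prob_space Q using Q by (simp add: random_allocation_def)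
interpretation PQ: pair_prob_space P Q ..

lemmas coordP = random_allocation_coordinate[OF P _ distA_blotto inv_eff_pos wt_pos pos(3,2)]
lemmas coordQ = random_allocation_coordinate[OF Q _ distB_blotto eff_pos wt_pos pos(2,3)]

lemma payoffA_integrable: "integrable (P \<Otimes>\<^sub>M Q) (\<lambda>(x, y). payoffA G x y)"
proof (rule PQ.integrable_const_bound)
  have [measurable]: "(\<lambda>z. fst z i) \<in> borel_measurable (P \<Otimes>\<^sub>M Q)"
      "(\<lambda>z. snd z i) \<in> borel_measurable (P \<Otimes>\<^sub>M Q)"
    if "i \<in> battlefields G" for i
    using measurable_compose[OF measurable_fst coordP(1)] measurable_compose[OF measurable_snd coordQ(1)] that
    by auto
  show "(\<lambda>(x, y). payoffA G x y) \<in> borel_measurable (P \<Otimes>\<^sub>M Q)"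
    unfolding payoffA_def case_prod_unfold by (intro borel_measurable_sum) measurable
  have "0 \<le> payoffA G x y \<and> payoffA G x y \<le> (\<Sum>i\<in>battlefields G. wt G i)" for x y
    unfolding payoffA_def using tie wt_pos
    by (auto intro!: sum_nonneg sum_mono mult_nonneg_nonneg mult_left_le simp: blotto_beta_def less_imp_le)
  then show "AE z in P \<Otimes>\<^sub>M Q. norm (case z of (x, y) \<Rightarrow> payoffA G x y) \<le> (\<Sum>i\<in>battlefields G. wt G i)"
    by (auto intro!: AE_I2)
qed

lemma payoffB_integrable: "integrable (P \<Otimes>\<^sub>M Q) (\<lambda>(x, y). payoffB G x y)"
  and payoffB_eq: "(\<integral>z. payoffB G (fst z) (snd z) \<partial>(P \<Otimes>\<^sub>M Q)) =
    (\<Sum>i\<in>battlefields G. wt G i) - (\<integral>z. payoffA G (fst z) (snd z) \<partial>(P \<Otimes>\<^sub>M Q))"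
proof -
  have eq: "payoffB G x y = (\<Sum>i\<in>battlefields G. wt G i) - payoffA G x y" for x y
    using payoff_sum[of G x y] by simp
  show "integrable (P \<Otimes>\<^sub>M Q) (\<lambda>(x, y). payoffB G x y)"
    unfolding eq using payoffA_integrable by (simp add: case_prod_unfold)
  show "(\<integral>z. payoffB G (fst z) (snd z) \<partial>(P \<Otimes>\<^sub>M Q)) =
    (\<Sum>i\<in>battlefields G. wt G i) - (\<integral>z. payoffA G (fst z) (snd z) \<partial>(P \<Otimes>\<^sub>M Q))"
    unfolding eq using payoffA_integrable by (simp add: case_prod_unfold PQ.prob_space)
qed

text \<open>Fubini reduces the mixed payoff to an average of payoffs of pure allocations. Their
  bound is affine, so its average depends only on the mean allocations, whatever the correlation
  between battlefields.\<close>

lemma payoffA_mixed_le: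
  "(\<integral>z. payoffA G (fst z) (snd z) \<partial>(P \<Otimes>\<^sub>M Q)) \<le> (\<Sum>i\<in>battlefields G. lagrangeA i) + budgetA G / a"
proof -
  let ?C = "\<Sum>i\<in>battlefields G. lagrangeA i"
  have int: "integrable P (\<lambda>x. \<Sum>i\<in>battlefields G. x i)"
    by (rule Bochner_Integration.integrable_sum) (rule coordP(3))
  have sum_eq: "(\<integral>x. (\<Sum>i\<in>battlefields G. x i) \<partial>P) =
      (\<Sum>i\<in>battlefields G. \<integral>x. x \<partial>interval_measure (distA G a b i))"
    by (subst Bochner_Integration.integral_sum) (intro coordP(3) coordP(4) sum.cong refl; assumption)+
  have "(\<integral>z. payoffA G (fst z) (snd z) \<partial>(P \<Otimes>\<^sub>M Q)) = (\<integral>x. \<integral>y. payoffA G x y \<partial>Q \<partial>P)"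
    using PQ.integral_fst[OF payoffA_integrable] by (simp add: case_prod_unfold)
  also have "\<dots> \<le> (\<integral>x. ?C + (\<Sum>i\<in>battlefields G. x i) / a \<partial>P)"
  proof (rule integral_mono_AE)
    show "integrable P (\<lambda>x. \<integral>y. payoffA G x y \<partial>Q)"
      using PQ.integrable_fst[OF payoffA_integrable] .
    show "integrable P (\<lambda>x. ?C + (\<Sum>i\<in>battlefields G. x i) / a)"
      using int by simp
    \<comment> \<open>\<open>P\<close> lives on all real vectors, so the nonnegativity required by
      the pure bound holds only almost surely.\<close>
    have "AE x in P. \<forall>i\<in>battlefields G. x i \<ge> 0"
      using coordP(2) by (simp add: AE_finite_all)
    then show "AE x in P. (\<integral>y. payoffA G x y \<partial>Q) \<le> ?C + (\<Sum>i\<in>battlefields G. x i) / a"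
      by eventually_elim (rule payoffA_pure_le[OF Q], blast)
  qed
  also have "\<dots> = ?C + (\<Sum>i\<in>battlefields G. \<integral>x. x \<partial>interval_measure (distA G a b i)) / a"
    using int sum_eq by (simp add: P.prob_space)
  also have "\<dots> \<le> ?C + budgetA G / a"
    using mean_distA_le pos(2) by (intro add_left_mono divide_right_mono) auto
  finally show ?thesis .
qed

lemma payoffB_mixed_le:
  "(\<integral>z. payoffB G (fst z) (snd z) \<partial>(P \<Otimes>\<^sub>M Q)) \<le> (\<Sum>i\<in>battlefields G. lagrangeB i) + budgetB G / b"
proof -
  let ?C = "\<Sum>i\<in>battlefields G. lagrangeB i"
  have int: "integrable Q (\<lambda>y. \<Sum>i\<in>battlefields G. y i)"
    by (rule Bochner_Integration.integrable_sum) (rule coordQ(3))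
  have sum_eq: "(\<integral>y. (\<Sum>i\<in>battlefields G. y i) \<partial>Q) =
      (\<Sum>i\<in>battlefields G. \<integral>x. x \<partial>interval_measure (distB G a b i))"
    by (subst Bochner_Integration.integral_sum) (intro coordQ(3) coordQ(4) sum.cong refl; assumption)+
  have "(\<integral>z. payoffB G (fst z) (snd z) \<partial>(P \<Otimes>\<^sub>M Q)) = (\<integral>y. \<integral>x. payoffB G x y \<partial>P \<partial>Q)"
    using PQ.integral_snd[OF payoffB_integrable] by (simp add: case_prod_unfold)
  also have "\<dots> \<le> (\<integral>y. ?C + (\<Sum>i\<in>battlefields G. y i) / b \<partial>Q)"
  proof (rule integral_mono_AE)
    show "integrable Q (\<lambda>y. \<integral>x. payoffB G x y \<partial>P)"
      using PQ.integrable_snd[OF payoffB_integrable] .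
    show "integrable Q (\<lambda>y. ?C + (\<Sum>i\<in>battlefields G. y i) / b)"
      using int by simp
    have "AE y in Q. \<forall>i\<in>battlefields G. y i \<ge> 0"
      using coordQ(2) by (simp add: AE_finite_all)
    then show "AE y in Q. (\<integral>x. payoffB G x y \<partial>P) \<le> ?C + (\<Sum>i\<in>battlefields G. y i) / b"
      by eventually_elim (rule payoffB_pure_le[OF P], blast)
  qed
  also have "\<dots> = ?C + (\<Sum>i\<in>battlefields G. \<integral>x. x \<partial>interval_measure (distB G a b i)) / b"
    using int sum_eq by (simp add: Q.prob_space)
  also have "\<dots> \<le> ?C + budgetB G / b"
    using mean_distB_le pos(3) by (intro add_left_mono divide_right_mono) auto
  finally show ?thesis .
qed

text \<open>The upper bound on the mixed payoff of player A is, by the constant sum and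
  \<open>value_sum\<close>, a lower bound on that of player B, and it coincides with the upper bound
  for every affordable pure allocation of player B.\<close>

lemma no_profitable_deviation_B:
  assumes "y \<in> pure_strategies G (budgetB G)"
  shows "(\<integral>x. payoffB G x y \<partial>P) \<le> (\<integral>z. payoffB G (fst z) (snd z) \<partial>(P \<Otimes>\<^sub>M Q))"
proof -
  have "(\<integral>x. payoffB G x y \<partial>P) \<le> (\<Sum>i\<in>battlefields G. lagrangeB i) + (\<Sum>i\<in>battlefields G. y i) / b"
    using assms by (intro payoffB_pure_le[OF P]) (auto simp: pure_strategies_def PiE_iff)
  also have "\<dots> \<le> (\<Sum>i\<in>battlefields G. lagrangeB i) + budgetB G / b"
    using assms pos(3) by (intro add_left_mono divide_right_mono) (auto simp: pure_strategies_def)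
  finally show ?thesis using payoffA_mixed_le payoffB_eq value_sum by linarith
qed

lemma no_profitable_deviation_A:
  assumes "x \<in> pure_strategies G (budgetA G)"
  shows "(\<integral>y. payoffA G x y \<partial>Q) \<le> (\<integral>z. payoffA G (fst z) (snd z) \<partial>(P \<Otimes>\<^sub>M Q))"
proof -
  have "(\<integral>y. payoffA G x y \<partial>Q) \<le> (\<Sum>i\<in>battlefields G. lagrangeA i) + (\<Sum>i\<in>battlefields G. x i) / a"
    using assms by (intro payoffA_pure_le[OF Q]) (auto simp: pure_strategies_def PiE_iff)
  also have "\<dots> \<le> (\<Sum>i\<in>battlefields G. lagrangeA i) + budgetA G / a"
    using assms pos(2) by (intro add_left_mono divide_right_mono) (auto simp: pure_strategies_def)
  finally show ?thesis using payoffB_mixed_le payoffB_eq value_sum by linarith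
qed

end

lemma optimal_univariate_dist: "optimal_univariate G (distA G a b) (distB G a b)"
proof -
  have A: "distribution_function (distA G a b i)" "msupport (interval_measure (distA G a b i)) \<subseteq> {0..}"
      "integrable (interval_measure (distA G a b i)) (\<lambda>x. x)" if "i \<in> battlefields G" for i
    unfolding distA_blotto[OF that] blotto_cdf_def
    by (rule distribution_function_threshold msupport_threshold integrable_threshold,
        (rule blotto_threshold[OF inv_eff_pos[OF that] wt_pos[OF that] pos(3,2)])+)+
  have B: "distribution_function (distB G a b i)" "msupport (interval_measure (distB G a b i)) \<subseteq> {0..}"
      "integrable (interval_measure (distB G a b i)) (\<lambda>x. x)" if "i \<in> battlefields G" for i
    unfolding distB_blotto[OF that] blotto_cdf_def
    by (rule distribution_function_threshold msupport_threshold integrable_threshold,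
        (rule blotto_threshold[OF eff_pos[OF that] wt_pos[OF that] pos(2,3)])+)+
  show ?thesis
    unfolding optimal_univariate_def
    by (intro conjI ballI allI impI A B mean_distA_le mean_distB_le
          no_profitable_deviation_A no_profitable_deviation_B)
qed

end

end

theorem theorem4p2:
  fixes G :: blotto_game
  assumes "blotto_favoritism G"
  shows "(\<exists>\<gamma>A \<gamma>B :: real. \<gamma>A > 0 \<and> \<gamma>B > 0 \<and> gA G \<gamma>A \<gamma>B = 0 \<and> gB G \<gamma>A \<gamma>B = 0) \<and>
    (\<forall>\<gamma>A \<gamma>B :: real. \<gamma>A > 0 \<and> \<gamma>B > 0 \<and> gA G \<gamma>A \<gamma>B = 0 \<and> gB G \<gamma>A \<gamma>B = 0 \<longrightarrow>
       optimal_univariate G (distA G \<gamma>A \<gamma>B) (distB G \<gamma>A \<gamma>B))"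
proof (intro conjI allI impI)
  have pos: "wt G i > 0 \<and> eff G i > 0" if "i \<in> battlefields G" for i
    using assms that unfolding blotto_favoritism_def by blast
  have n: "num_bf G \<ge> 3" and budgets: "budgetB G > 0" "budgetA G > 0" and tie: "0 \<le> tie G" "tie G \<le> 1"
    using assms unfolding blotto_favoritism_def by linarith+
  have "battlefields G \<noteq> {}" using n by simp
  from spending_equilibrium_exists[OF finite_atLeastAtMost this, of "eff G" "wt G", OF _ budgets] pos
  obtain a b where ab: "a > 0" "b > 0"
    and eq: "(\<Sum>i\<in>battlefields G. spending (eff G i) (wt G i) (pre G i) a b) = budgetB G * a"
      "(\<Sum>i\<in>battlefields G. spending (1 / eff G i) (wt G i) (- pre G i / eff G i) b a) = budgetA G * b"
    by blast
  have "gA G a b = 0" "gB G a b = 0"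
    using sum_spending_gA[OF pos ab] sum_spending_gB[OF pos ab] eq by simp_all
  with ab show "\<exists>\<gamma>A \<gamma>B. \<gamma>A > 0 \<and> \<gamma>B > 0 \<and> gA G \<gamma>A \<gamma>B = 0 \<and> gB G \<gamma>A \<gamma>B = 0"
    by blast
  show "optimal_univariate G (distA G \<gamma>A \<gamma>B) (distB G \<gamma>A \<gamma>B)"
    if "\<gamma>A > 0 \<and> \<gamma>B > 0 \<and> gA G \<gamma>A \<gamma>B = 0 \<and> gB G \<gamma>A \<gamma>B = 0" for \<gamma>A \<gamma>B
    using that pos tie by (intro optimal_univariate_dist) auto
qed

end
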